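(* Let $G$ be an $(s,k)$-edge-connected graph such that $k\geq 2$ and $\deg(s)>4$. Then: (i) If $L(G,s,k)$ is disconnected, then $\deg(s)$ is odd and $L(G,s,k)$ is the disjoint union of an isolated vertex and a balanced complete bipartite graph. (ii) If $k$ is even, then $L(G,s,k)$ is either a complete multipartite graph or the disjoint union of an isolated vertex and a balanced complete bipartite graph. (iii) If the complement of $L(G,s,k)$ is connected, then this complement is either a Hamilton cycle or two cliques of the same size joined by a path, and $k$ is odd except possibly when $L(G,s,k)$ is as in (i) (where $k$ may be even or odd). Moreover, $G$ has an $(s,r)$-cycle structure or an $(s,r)$-path structure (correspondingly), where $r=(k-1)/2$, except possibly when $L(G,s,k)$ is as in (i), in which case only $r\geq (k-1)/2$ is asserted. Furthermore, the subgraph of $G$ induced by each blob of this structure is $\lceil k/2\rceil$-edge-connected, except possibly the middle blob (of the three blobs) when $L(G,s,k)$ is as in (i).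
   Context: All graphs are finite loopless multigraphs. For $X\subseteq V(G)$, $\delta(X)$ is the set of edges with exactly one end in $X$. A graph $G$ is $(s,k)$-edge-connected if $G$ has at least three vertices, $s$ is a vertex of $G$, $k$ is a positive integer, and any two vertices of $G$ both different from $s$ are joined by $k$ pairwise edge-disjoint paths in $G$ (these paths may pass through $s$). Lifting two edges $sv,sw$ incident with $s$ means deleting them and adding a new edge $vw$ if $v\neq w$, and only deleting them if $v=w$ (parallel edges); call the result $G_{v,w}$. Edges $sv,sw$ form a $k$-liftable pair if $G_{v,w}$ is $(s,k)$-edge-connected. The $k$-lifting graph $L(G,s,k)$ has as vertices the edges of $G$ incident with $s$, two being adjacent iff they form a $k$-liftable pair. Path/cycle structure: let $r\geq 1$, $n\geq 3$, and suppose $G-s$ has pairwise disjoint subgraphs $H_0,\dots,H_{n-1}$ (the blobs) whose vertex sets cover $V(G-s)$. $G$ has an $(s,r)$-cycle structure if for every $i=0,\dots,n-1$, $\delta(H_i)$ consists of exactly $2r+1$ edges: one edge with other end $s$, $r$ edges with other ends in $H_{i-1}$ and $r$ edges with other ends in $H_{i+1}$ (indices mod $n$). $G$ has an $(s,r)$-path structure if the same holds for every $i=1,\dots,n-2$ (no condition is imposed on $H_0$ and $H_{n-1}$). "Two cliques joined by a path" allows the path to have length $0$ (the two cliques share a vertex). *)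

theory Defs
  imports Complex_Main "HOL-Library.Disjoint_Sets"
begin

record ('v, 'e) mgraph =
  verts :: "'v set"
  edges :: "'e set"
  ends :: "'e \<Rightarrow> 'v set"

definition finite_loopless_multigraph :: "('v, 'e) mgraph \<Rightarrow> bool" where
  "finite_loopless_multigraph G \<longleftrightarrow> finite (verts G) \<and> finite (edges G) \<and>
     (\<forall>e\<in>edges G. ends G e \<subseteq> verts G \<and> card (ends G e) = 2)"

definition edge_cut :: "('v, 'e) mgraph \<Rightarrow> 'v set \<Rightarrow> 'e set" where
  "edge_cut G X = {e \<in> edges G. card (ends G e \<inter> X) = 1}"

definition incident_edges :: "('v, 'e) mgraph \<Rightarrow> 'v \<Rightarrow> 'e set" where
  "incident_edges G v = {e \<in> edges G. v \<in> ends G e}"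

definition degree :: "('v, 'e) mgraph \<Rightarrow> 'v \<Rightarrow> nat" where
  "degree G v = card (incident_edges G v)"

definition adjacent :: "('v, 'e) mgraph \<Rightarrow> 'v \<Rightarrow> 'v \<Rightarrow> bool" where
  "adjacent G u v \<longleftrightarrow> (\<exists>e\<in>edges G. ends G e = {u, v})"

definition induced_subgraph :: "('v, 'e) mgraph \<Rightarrow> 'v set \<Rightarrow> ('v, 'e) mgraph" where
  "induced_subgraph G X = G\<lparr>verts := verts G \<inter> X, edges := {e \<in> edges G. ends G e \<subseteq> X}\<rparr>"

text \<open>A path is given by its list of vertices \<open>vs\<close> together with its list of edges \<open>es\<close>.\<close>

definition is_path :: "('v, 'e) mgraph \<Rightarrow> 'v list \<Rightarrow> 'e list \<Rightarrow> bool" where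
  "is_path G vs es \<longleftrightarrow> length vs = Suc (length es) \<and> distinct vs \<and>
     set vs \<subseteq> verts G \<and> set es \<subseteq> edges G \<and>
     (\<forall>i<length es. ends G (es ! i) = {vs ! i, vs ! Suc i})"

definition path_between :: "('v, 'e) mgraph \<Rightarrow> 'v \<Rightarrow> 'v \<Rightarrow> 'e list \<Rightarrow> bool" where
  "path_between G u v es \<longleftrightarrow> (\<exists>vs. is_path G vs es \<and> hd vs = u \<and> last vs = v)"

definition edge_disjoint_paths :: "('v, 'e) mgraph \<Rightarrow> nat \<Rightarrow> 'v \<Rightarrow> 'v \<Rightarrow> bool" where
  "edge_disjoint_paths G k u v \<longleftrightarrow>
     (\<exists>P. (\<forall>i<k. path_between G u v (P i)) \<and> disjoint_family_on (\<lambda>i. set (P i)) {..<k})"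

definition connected_graph :: "('v, 'e) mgraph \<Rightarrow> bool" where
  "connected_graph G \<longleftrightarrow> (\<forall>u\<in>verts G. \<forall>v\<in>verts G. \<exists>es. path_between G u v es)"

text \<open>One-vertex graphs are \<open>k\<close>-edge-connected for every \<open>k\<close>.\<close>

definition edge_connected :: "nat \<Rightarrow> ('v, 'e) mgraph \<Rightarrow> bool" where
  "edge_connected k G \<longleftrightarrow>
     (\<forall>u\<in>verts G. \<forall>v\<in>verts G. u \<noteq> v \<longrightarrow> edge_disjoint_paths G k u v)"

definition sk_edge_connected :: "('v, 'e) mgraph \<Rightarrow> 'v \<Rightarrow> nat \<Rightarrow> bool" where
  "sk_edge_connected G s k \<longleftrightarrow> card (verts G) \<ge> 3 \<and> s \<in> verts G \<and> k > 0 \<and>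
     (\<forall>u\<in>verts G - {s}. \<forall>v\<in>verts G - {s}. u \<noteq> v \<longrightarrow> edge_disjoint_paths G k u v)"

definition other_end :: "('v, 'e) mgraph \<Rightarrow> 'v \<Rightarrow> 'e \<Rightarrow> 'v" where
  "other_end G s e = the_elem (ends G e - {s})"

text \<open>When the other ends \<open>v\<close> and \<open>w\<close> differ, the name \<open>e\<close> is reused for the new edge \<open>vw\<close>.\<close>

definition lift_edges :: "('v, 'e) mgraph \<Rightarrow> 'v \<Rightarrow> 'e \<Rightarrow> 'e \<Rightarrow> ('v, 'e) mgraph" where
  "lift_edges G s e f =
     (let v = other_end G s e; w = other_end G s f in
      if v = w then G\<lparr>edges := edges G - {e, f}\<rparr>
      else G\<lparr>edges := edges G - {f}, ends := (ends G)(e := {v, w})\<rparr>)"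

definition liftable_pair :: "('v, 'e) mgraph \<Rightarrow> 'v \<Rightarrow> nat \<Rightarrow> 'e \<Rightarrow> 'e \<Rightarrow> bool" where
  "liftable_pair G s k e f \<longleftrightarrow> e \<in> incident_edges G s \<and> f \<in> incident_edges G s \<and> e \<noteq> f \<and>
     sk_edge_connected (lift_edges G s e f) s k"

text \<open>Simple graphs are multigraphs whose edges are their own sets of ends.\<close>

type_synonym 'a sgraph = "('a, 'a set) mgraph"

definition simple_graph :: "'a set \<Rightarrow> ('a \<Rightarrow> 'a \<Rightarrow> bool) \<Rightarrow> 'a sgraph" where
  "simple_graph V R =
     \<lparr>verts = V, edges = {{u, v} | u v. u \<in> V \<and> v \<in> V \<and> u \<noteq> v \<and> R u v}, ends = (\<lambda>e. e)\<rparr>"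

definition complement_graph :: "'a sgraph \<Rightarrow> 'a sgraph" where
  "complement_graph H = simple_graph (verts H) (\<lambda>u v. \<not> adjacent H u v)"

definition lifting_graph :: "('v, 'e) mgraph \<Rightarrow> 'v \<Rightarrow> nat \<Rightarrow> 'e sgraph" where
  "lifting_graph G s k = simple_graph (incident_edges G s) (liftable_pair G s k)"

definition isolated_plus_balanced_complete_bipartite :: "'a sgraph \<Rightarrow> bool" where
  "isolated_plus_balanced_complete_bipartite H \<longleftrightarrow>
     (\<exists>x A B. verts H = {x} \<union> A \<union> B \<and> x \<notin> A \<and> x \<notin> B \<and> A \<inter> B = {} \<and> card A = card B \<and>
        (\<forall>u\<in>verts H. \<forall>v\<in>verts H. adjacent H u v \<longleftrightarrow> (u \<in> A \<and> v \<in> B) \<or> (u \<in> B \<and> v \<in> A)))"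

text \<open>At least two parts are required, so edgeless graphs on two or more vertices are excluded.\<close>

definition complete_multipartite :: "'a sgraph \<Rightarrow> bool" where
  "complete_multipartite H \<longleftrightarrow>
     (\<exists>P. partition_on (verts H) P \<and> card P \<ge> 2 \<and>
        (\<forall>u\<in>verts H. \<forall>v\<in>verts H. adjacent H u v \<longleftrightarrow> \<not> (\<exists>X\<in>P. u \<in> X \<and> v \<in> X)))"

definition is_hamilton_cycle :: "'a sgraph \<Rightarrow> bool" where
  "is_hamilton_cycle H \<longleftrightarrow>
     (\<exists>c. length c \<ge> 3 \<and> distinct c \<and> set c = verts H \<and>
        (\<forall>u\<in>verts H. \<forall>v\<in>verts H. adjacent H u v \<longleftrightarrow>
           (\<exists>i<length c. {u, v} = {c ! i, c ! (Suc i mod length c)})))"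

text \<open>The cliques are \<open>A\<close> and \<open>B\<close>, and \<open>p\<close> is the vertex list of the joining path. If \<open>p\<close> has at
  least two vertices, the conditions force \<open>A\<close> and \<open>B\<close> to be disjoint; if \<open>p = [x]\<close>, they force
  \<open>A \<inter> B = {x}\<close>.\<close>

definition two_equal_cliques_joined_by_path :: "'a sgraph \<Rightarrow> bool" where
  "two_equal_cliques_joined_by_path H \<longleftrightarrow>
     (\<exists>A B p. verts H = A \<union> B \<union> set p \<and> card A = card B \<and> p \<noteq> [] \<and> distinct p \<and>
        A \<inter> set p = {hd p} \<and> B \<inter> set p = {last p} \<and> A \<inter> B \<subseteq> set p \<and>
        (\<forall>u\<in>verts H. \<forall>v\<in>verts H. adjacent H u v \<longleftrightarrow> u \<noteq> v \<and>
           ((u \<in> A \<and> v \<in> A) \<or> (u \<in> B \<and> v \<in> B) \<or>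
            (\<exists>i. Suc i < length p \<and> {u, v} = {p ! i, p ! Suc i}))))"

text \<open>Blobs are represented by their vertex sets \<open>H 0, \<dots>, H (n - 1)\<close>.\<close>

definition blob_cover :: "('v, 'e) mgraph \<Rightarrow> 'v \<Rightarrow> nat \<Rightarrow> (nat \<Rightarrow> 'v set) \<Rightarrow> bool" where
  "blob_cover G s n H \<longleftrightarrow> disjoint_family_on H {..<n} \<and> (\<Union>i<n. H i) = verts G - {s}"

definition blob_condition ::
  "('v, 'e) mgraph \<Rightarrow> 'v \<Rightarrow> nat \<Rightarrow> 'v set \<Rightarrow> 'v set \<Rightarrow> 'v set \<Rightarrow> bool" where
  "blob_condition G s r Y X Z \<longleftrightarrow> card (edge_cut G X) = 2 * r + 1 \<and>
     card {e \<in> edge_cut G X. s \<in> ends G e} = 1 \<and>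
     card {e \<in> edge_cut G X. ends G e \<inter> Y \<noteq> {}} = r \<and>
     card {e \<in> edge_cut G X. ends G e \<inter> Z \<noteq> {}} = r"

definition cycle_structure :: "('v, 'e) mgraph \<Rightarrow> 'v \<Rightarrow> nat \<Rightarrow> nat \<Rightarrow> (nat \<Rightarrow> 'v set) \<Rightarrow> bool" where
  "cycle_structure G s r n H \<longleftrightarrow> r \<ge> 1 \<and> n \<ge> 3 \<and> blob_cover G s n H \<and>
     (\<forall>i<n. blob_condition G s r (H ((i + n - 1) mod n)) (H i) (H ((i + 1) mod n)))"

definition path_structure :: "('v, 'e) mgraph \<Rightarrow> 'v \<Rightarrow> nat \<Rightarrow> nat \<Rightarrow> (nat \<Rightarrow> 'v set) \<Rightarrow> bool" where
  "path_structure G s r n H \<longleftrightarrow> r \<ge> 1 \<and> n \<ge> 3 \<and> blob_cover G s n H \<and>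
     (\<forall>i. 1 \<le> i \<and> i \<le> n - 2 \<longrightarrow> blob_condition G s r (H (i - 1)) (H i) (H (i + 1)))"

end

theory Submission
  imports Defs
begin

text \<open>For a vertex set \<open>X\<close> avoiding \<open>s\<close> let \<open>d X\<close> be the size of its cut and \<open>star X\<close> the set of
  edges from \<open>s\<close> to \<open>X\<close>. By Menger's theorem two edges at \<open>s\<close> fail to be liftable iff both lie in
  \<open>star X\<close> for some \<open>X\<close>, nonempty and different from \<open>V - s\<close>, with \<open>d X \<le> k + 1\<close>. So the complement
  of the lifting graph is the union of the cliques \<open>star X\<close> over the maximal such sets (blocks).
  Uncrossing shows that two blocks share at most one edge and that no edge lies in three blocks. If
  \<open>X\<close> and \<open>Y\<close> share an edge, then either they cover \<open>V - s\<close>, which is the exceptional case of an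
  isolated vertex plus a balanced complete bipartite graph, or \<open>k = 2 r + 1\<close>, \<open>d (X \<inter> Y) = k\<close>, and
  \<open>X \<inter> Y\<close> sends \<open>r\<close> edges to each of \<open>X - Y\<close> and \<open>Y - X\<close> and one to \<open>s\<close>. In the latter case a block
  sharing two edges with other blocks has no further edges at \<open>s\<close>, so the blocks form a path or a
  cycle, and the intersections of consecutive blocks are the blobs.\<close>

section \<open>Menger's theorem for edge cuts\<close>

text \<open>Maximality drives the uncrossing. If two overlapping blocks do not cover
  \<open>V - s\<close>, their union is not dangerous, so its cut has at least \<open>k + 2\<close>
  edges, and this makes the submodular count tight everywhere. If they cover \<open>V - s\<close>,
  that bound is lost; hence the exceptional case and the weaker control of its middle blob. All size
  estimates come from the complement: as \<open>V - s - X\<close> also has a cut of at least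
  \<open>k\<close> edges, a block holds at most \<open>(deg(s) + 1) / 2\<close> edges at
  \<open>s\<close>, and two overlapping blocks that do not cover \<open>V - s\<close> hold at most
  \<open>(deg(s) + 2) / 2\<close> together. Degenerate configurations violate these bounds once
  \<open>deg(s) > 4\<close>. The hypothesis \<open>k \<ge> 2\<close> excludes an edge in three
  blocks, since the count there reads \<open>4 k + 2 \<le> 3 (k + 1)\<close>. That the blobs exhaust
  \<open>V - s\<close> needs its own argument: a leftover set would have no edge to \<open>s\<close>
  and fewer than \<open>k\<close> edges to the blobs.\<close>

lemma edge_ends:
  assumes "finite_loopless_multigraph G" "e \<in> edges G"
  obtains x y where "ends G e = {x, y}" "x \<noteq> y" "x \<in> verts G" "y \<in> verts G"
  using assms unfolding finite_loopless_multigraph_def by (metis card_2_iff insert_subset)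

lemma edge_cut_iff:
  assumes "ends G e = {x, y}" "x \<noteq> y"
  shows "e \<in> edge_cut G X \<longleftrightarrow> e \<in> edges G \<and> (x \<in> X) \<noteq> (y \<in> X)"
proof -
  have "{x, y} \<inter> X = (if x \<in> X then if y \<in> X then {x, y} else {x} else if y \<in> X then {y} else {})"
    by auto
  then show ?thesis using assms unfolding edge_cut_def by simp
qed

section \<open>Integral flows with unit edge capacities\<close>

definition arcs :: "('v, 'e) mgraph \<Rightarrow> ('e \<times> 'v \<times> 'v) set" where
  "arcs G = {(e, x, y). e \<in> edges G \<and> ends G e = {x, y}}"

definition net :: "('e \<times> 'v \<times> 'v) set \<Rightarrow> 'v \<Rightarrow> int" where
  "net A z = (\<Sum>(e, x, y)\<in>A. of_bool (z = x) - of_bool (z = y))"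

definition unit_flow :: "('v, 'e) mgraph \<Rightarrow> ('e \<times> 'v \<times> 'v) set \<Rightarrow> bool" where
  "unit_flow G A \<longleftrightarrow> A \<subseteq> arcs G \<and> inj_on fst A"

lemma finite_arcs:
  assumes "finite_loopless_multigraph G"
  shows "finite (arcs G)"
proof (rule finite_subset)
  show "arcs G \<subseteq> edges G \<times> verts G \<times> verts G"
    using assms by (force simp: arcs_def finite_loopless_multigraph_def)
  show "finite (edges G \<times> verts G \<times> verts G)"
    using assms by (simp add: finite_loopless_multigraph_def)
qed

lemma unit_flow_finite:
  assumes "finite_loopless_multigraph G" "unit_flow G A"
  shows "finite A"
  using assms finite_arcs finite_subset unfolding unit_flow_def by blast

text \<open>Exchanging the sums cancels every arc with both ends in \<open>R\<close>, so only the
  arcs leaving or entering \<open>R\<close> count.\<close>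

lemma sum_net:
  assumes "finite R"
  shows "(\<Sum>z\<in>R. net A z) = (\<Sum>(e, x, y)\<in>A. of_bool (x \<in> R) - of_bool (y \<in> R))"
proof -
  have eq: "(\<Sum>z\<in>R. of_bool (z = x) :: int) = of_bool (x \<in> R)" for x
    using assms by (simp add: of_bool_def)
  have "(\<Sum>z\<in>R. net A z) = (\<Sum>a\<in>A. \<Sum>z\<in>R. case a of (e, x, y) \<Rightarrow> of_bool (z = x) - of_bool (z = y))"
    unfolding net_def by (rule sum.swap)
  also have "\<dots> = (\<Sum>(e, x, y)\<in>A. of_bool (x \<in> R) - of_bool (y \<in> R))"
    by (intro sum.cong refl) (auto simp: sum_subtractf eq)
  finally show ?thesis .
qed

lemma rtranclp_simple_path:
  assumes "R\<^sup>*\<^sup>* u v"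
  shows "\<exists>vs. vs \<noteq> [] \<and> hd vs = u \<and> last vs = v \<and> distinct vs \<and> successively R vs"
  using assms
proof (induction rule: converse_rtranclp_induct)
  case base
  show ?case by (rule exI[of _ "[v]"]) simp
next
  case (step u w)
  then obtain ws where ws: "ws \<noteq> []" "hd ws = w" "last ws = v" "distinct ws" "successively R ws"
    by blast
  show ?case
  proof (cases "u \<in> set ws")
    case True
    \<comment> \<open>If \<open>u\<close> occurs on the path from \<open>w\<close>, the part from
      that occurrence on is already a simple path.\<close>
    then obtain as bs where "ws = as @ u # bs" by (meson split_list)
    with ws show ?thesis
      by (intro exI[of _ "u # bs"]) (auto simp: successively_append_iff)
  next
    case False
    with ws step(1) show ?thesis
      by (intro exI[of _ "u # ws"]) (auto simp: successively_Cons)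
  qed
qed

text \<open>One unit is pushed along a residual path: an arc whose reversal carries flow cancels it,
  any other arc is added.\<close>

lemma unit_flow_augment:
  assumes G: "finite_loopless_multigraph G"
  shows "\<lbrakk>unit_flow G A; vs \<noteq> []; distinct vs;
    successively (\<lambda>x y. \<exists>e. (e, x, y) \<in> arcs G - A) vs\<rbrakk> \<Longrightarrow>
    \<exists>B. unit_flow G B \<and> (\<forall>z. net B z = net A z + of_bool (z = hd vs) - of_bool (z = last vs))"
proof (induction vs arbitrary: A)
  case Nil
  then show ?case by simp
next
  case (Cons x ws)
  show ?case
  proof (cases ws)
    case Nil
    then show ?thesis using Cons.prems by auto
  next
    case (Cons y us)
    obtain e where e: "(e, x, y) \<in> arcs G" "(e, x, y) \<notin> A"
      using Cons.prems Cons by auto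
    have xy: "x \<noteq> y" using Cons.prems Cons by auto
    note fin = unit_flow_finite[OF G Cons.prems(1)]
    define A1 where "A1 = (if (e, y, x) \<in> A then A - {(e, y, x)} else insert (e, x, y) A)"
    have A: "A \<subseteq> arcs G" "inj_on fst A" using Cons.prems(1) by (auto simp: unit_flow_def)
    have flow: "unit_flow G A1"
    proof (cases "(e, y, x) \<in> A")
      case True
      then show ?thesis using A unfolding A1_def unit_flow_def by (auto simp: inj_on_diff)
    next
      case False
      have "e \<notin> fst ` A"
      proof
        assume "e \<in> fst ` A"
        then obtain a b where ab: "(e, a, b) \<in> A" by force
        then have "{a, b} = {x, y}" using A(1) e(1) by (auto simp: arcs_def)
        then show False using ab e(2) False by (auto simp: doubleton_eq_iff)
      qed
      then show ?thesis using A e(1) False unfolding A1_def unit_flow_def by auto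
    qed
    have net: "net A1 z = net A z + of_bool (z = x) - of_bool (z = y)" for z
    proof (cases "(e, y, x) \<in> A")
      case True
      then show ?thesis using fin unfolding A1_def net_def by (simp add: sum_diff1)
    next
      case False
      then show ?thesis using fin e(2) unfolding A1_def net_def by simp
    qed
    have "successively (\<lambda>x y. \<exists>e. (e, x, y) \<in> arcs G - A) ws"
      using Cons.prems(4) Cons by simp
    then have succ: "successively (\<lambda>x y. \<exists>e. (e, x, y) \<in> arcs G - A1) ws"
    proof (rule successively_mono)
      \<comment> \<open>The flow has gained at most an arc leaving \<open>x\<close>, and the rest of
        the path avoids \<open>x\<close>, so its arcs are still residual.\<close>
      fix a b assume ab: "a \<in> set ws" "\<exists>e. (e, a, b) \<in> arcs G - A"
      have "a \<noteq> x" using ab Cons.prems by auto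
      then show "\<exists>e. (e, a, b) \<in> arcs G - A1" using ab unfolding A1_def by auto
    qed
    obtain B where "unit_flow G B"
      "\<forall>z. net B z = net A1 z + of_bool (z = hd ws) - of_bool (z = last ws)"
      using Cons.IH[OF flow _ _ succ] Cons.prems Cons by auto
    then show ?thesis using net Cons by (intro exI[of _ B]) auto
  qed
qed

text \<open>Ford-Fulkerson: if no residual path reached \<open>v\<close>, all edges leaving the
  reachable set would carry flow outwards and none inwards, so its cut would have size
  \<open>j < k\<close>.\<close>

lemma unit_flow_exists:
  assumes G: "finite_loopless_multigraph G" and uv: "u \<in> verts G" "v \<in> verts G" "u \<noteq> v"
    and cut: "\<And>X. X \<subseteq> verts G \<Longrightarrow> u \<in> X \<Longrightarrow> v \<notin> X \<Longrightarrow> k \<le> card (edge_cut G X)"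
  shows "j \<le> k \<Longrightarrow>
    \<exists>A. unit_flow G A \<and> (\<forall>z. net A z = int j * (of_bool (z = u) - of_bool (z = v)))"
proof (induction j)
  case 0
  show ?case by (rule exI[of _ "{}"]) (simp add: unit_flow_def net_def)
next
  case (Suc j)
  then obtain A where A: "unit_flow G A"
    and netA: "\<And>z. net A z = int j * (of_bool (z = u) - of_bool (z = v))" by auto
  note fin = unit_flow_finite[OF G A]
  have sub: "A \<subseteq> arcs G" "inj_on fst A" using A by (auto simp: unit_flow_def)
  define R where "R = (\<lambda>x y. \<exists>e. (e, x, y) \<in> arcs G - A)"
  define X where "X = {x. R\<^sup>*\<^sup>* u x}"
  have RV: "y \<in> verts G" if "R x y" for x y
    using that G by (auto simp: R_def arcs_def finite_loopless_multigraph_def)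
  have "x \<in> verts G" if "R\<^sup>*\<^sup>* u x" for x
    using that by (induction rule: rtranclp_induct) (use uv RV in auto)
  then have XV: "X \<subseteq> verts G" by (auto simp: X_def)
  then have finX: "finite X" using G finite_subset by (auto simp: finite_loopless_multigraph_def)
  have uX: "u \<in> X" by (simp add: X_def)
  have step: "y \<in> X" if "x \<in> X" "R x y" for x y using that by (auto simp: X_def)
  have "v \<in> X"
  proof (rule ccontr)
    assume vX: "v \<notin> X"
    have "int k \<le> int (card (edge_cut G X))" using cut[OF XV uX vX] by simp
    also have "edge_cut G X \<subseteq> fst ` {(e, x, y). (e, x, y) \<in> A \<and> x \<in> X \<and> y \<notin> X}"
    proof
      fix e assume e: "e \<in> edge_cut G X"
      then have eG: "e \<in> edges G" by (simp add: edge_cut_def)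
      obtain a b where ab: "ends G e = {a, b}" "a \<noteq> b" by (rule edge_ends[OF G eG])
      then obtain x y where xy: "ends G e = {x, y}" "x \<in> X" "y \<notin> X"
        using e edge_cut_iff[OF ab] by (metis doubleton_eq_iff)
      then have "(e, x, y) \<in> A" using step[of x y] eG by (auto simp: R_def arcs_def)
      then show "e \<in> fst ` {(e, x, y). (e, x, y) \<in> A \<and> x \<in> X \<and> y \<notin> X}" using xy by force
    qed
    then have "card (edge_cut G X) \<le> card {(e, x, y). (e, x, y) \<in> A \<and> x \<in> X \<and> y \<notin> X}"
      by (rule surj_card_le[rotated]) (rule finite_subset[OF _ fin], auto)
    also have "int (card {(e, x, y). (e, x, y) \<in> A \<and> x \<in> X \<and> y \<notin> X})
        = (\<Sum>a\<in>A. of_bool (a \<in> {(e, x, y). (e, x, y) \<in> A \<and> x \<in> X \<and> y \<notin> X}))"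
      using fin by (simp add: of_bool_def sum.If_cases Int_def case_prod_unfold)
    also have "\<dots> = (\<Sum>(e, x, y)\<in>A. of_bool (x \<in> X) - of_bool (y \<in> X))"
    proof (intro sum.cong refl)
      fix a assume a: "a \<in> A"
      obtain e x y where [simp]: "a = (e, x, y)" by (cases a)
      have e: "e \<in> edges G" "ends G e = {x, y}" using a sub(1) by (auto simp: arcs_def)
      then have "card {x, y} = 2" using G by (auto simp: finite_loopless_multigraph_def)
      then have "x \<noteq> y" by auto
      then have "(e, y, x) \<notin> A" using a inj_onD[OF sub(2), of "(e, x, y)" "(e, y, x)"] by auto
      moreover have arc: "(e, y, x) \<in> arcs G" using e by (auto simp: arcs_def)
      ultimately have "R y x" unfolding R_def by blast
      \<comment> \<open>The reversal of a flow arc is residual, so no flow arc enters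
        \<open>X\<close> and no summand is -1.\<close>
      then have "y \<in> X \<Longrightarrow> x \<in> X" using step[of y x] by blast
      then show "of_bool (a \<in> {(e, x, y). (e, x, y) \<in> A \<and> x \<in> X \<and> y \<notin> X}) =
        ((case a of (e, x, y) \<Rightarrow> of_bool (x \<in> X) - of_bool (y \<in> X)) :: int)"
        using a by auto
    qed
    also have "\<dots> = (\<Sum>z\<in>X. net A z)" by (rule sum_net[OF finX, symmetric])
    also have "\<dots> = int j * (\<Sum>z\<in>X. of_bool (z = u) - of_bool (z = v))"
      by (simp add: netA sum_distrib_left)
    also have "(\<Sum>z\<in>X. of_bool (z = u) - of_bool (z = v)) = (1::int)"
      using finX uX vX by (simp add: sum_subtractf of_bool_def)
    finally show False using Suc.prems by simp
  qed
  then obtain vs where "vs \<noteq> []" "hd vs = u" "last vs = v" "distinct vs" "successively R vs"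
    using rtranclp_simple_path[of R u v] by (auto simp: X_def)
  then obtain B where B: "unit_flow G B"
    "\<forall>z. net B z = net A z + of_bool (z = u) - of_bool (z = v)"
    using unit_flow_augment[OF G A, of vs] unfolding R_def by auto
  then show ?case
    by (intro exI[of _ B]) (auto simp: netA algebra_simps)
qed

text \<open>Following flow arcs from \<open>u\<close> must reach \<open>v\<close>, since a set
  closed under them has no positive excess. Deleting the path found lowers the value by one;
  circulations in \<open>A\<close> are simply left over at the end.\<close>

lemma unit_flow_paths:
  assumes G: "finite_loopless_multigraph G" and uv: "u \<in> verts G" "u \<noteq> v"
  shows "\<lbrakk>unit_flow G A; \<And>z. net A z = int j * (of_bool (z = u) - of_bool (z = v))\<rbrakk> \<Longrightarrow>
    \<exists>P. (\<forall>i<j. path_between G u v (P i) \<and> set (P i) \<subseteq> fst ` A) \<and>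
      disjoint_family_on (\<lambda>i. set (P i)) {..<j}"
proof (induction j arbitrary: A)
  case 0
  show ?case by (simp add: disjoint_family_on_def)
next
  case (Suc j)
  note fin = unit_flow_finite[OF G Suc.prems(1)]
  have sub: "A \<subseteq> arcs G" "inj_on fst A" using Suc.prems by (auto simp: unit_flow_def)
  define R where "R = (\<lambda>x y. \<exists>e. (e, x, y) \<in> A)"
  define X where "X = {x. R\<^sup>*\<^sup>* u x}"
  have RV: "y \<in> verts G" if "R x y" for x y
    using that G sub by (force simp: R_def arcs_def finite_loopless_multigraph_def)
  have "x \<in> verts G" if "R\<^sup>*\<^sup>* u x" for x
    using that by (induction rule: rtranclp_induct) (use uv RV in auto)
  then have XV: "X \<subseteq> verts G" by (auto simp: X_def)
  then have finX: "finite X" using G finite_subset by (auto simp: finite_loopless_multigraph_def)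
  have uX: "u \<in> X" by (simp add: X_def)
  have step: "y \<in> X" if "x \<in> X" "R x y" for x y using that by (auto simp: X_def)
  have "v \<in> X"
  proof (rule ccontr)
    assume vX: "v \<notin> X"
    have "int (Suc j) = (\<Sum>z\<in>X. net A z)"
      using finX uX vX
      by (simp add: Suc.prems(2) flip: sum_distrib_left) (simp add: sum_subtractf of_bool_def)
    also have "\<dots> = (\<Sum>(e, x, y)\<in>A. of_bool (x \<in> X) - of_bool (y \<in> X))"
      by (rule sum_net[OF finX])
    also have "\<dots> \<le> 0"
          proof (rule sum_nonpos)
      fix a assume a: "a \<in> A"
      obtain e x y where [simp]: "a = (e, x, y)" by (cases a)
      have "x \<in> X \<Longrightarrow> y \<in> X" using step[of x y] a unfolding R_def by auto
      then show "(case a of (e, x, y) \<Rightarrow> of_bool (x \<in> X) - of_bool (y \<in> X)) \<le> (0::int)" by simp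
    qed
    finally show False by simp
  qed
  then obtain vs where vs: "vs \<noteq> []" "hd vs = u" "last vs = v" "distinct vs" "successively R vs"
    using rtranclp_simple_path[of R u v] by (auto simp: X_def)
  define n where "n = length vs - 1"
  have len: "length vs = Suc n" using vs(1) by (cases vs) (auto simp: n_def)
  have "\<forall>i. \<exists>e. i < n \<longrightarrow> (e, vs ! i, vs ! Suc i) \<in> A"
    using vs(5) len unfolding successively_conv_nth R_def by auto
  then obtain h where h: "\<And>i. i < n \<Longrightarrow> (h i, vs ! i, vs ! Suc i) \<in> A" by metis
  define es where "es = map h [0..<n]"
  define B where "B = (\<lambda>i. (h i, vs ! i, vs ! Suc i)) ` {..<n}"
  have inj: "inj_on (\<lambda>i. (h i, vs ! i, vs ! Suc i)) {..<n}"
    using vs(4) len by (auto simp: inj_on_def nth_eq_iff_index_eq)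
  have BA: "B \<subseteq> A" using h by (auto simp: B_def)
  have setes: "set es = fst ` B" by (simp add: es_def B_def image_image atLeast0LessThan)
  have netB: "net B z = of_bool (z = u) - of_bool (z = v)" for z
  proof -
    have "net B z = (\<Sum>i<n. of_bool (z = vs ! i) - of_bool (z = vs ! Suc i))"
      unfolding net_def B_def by (simp add: sum.reindex[OF inj])
    also have "\<dots> = of_bool (z = vs ! 0) - of_bool (z = vs ! n)"
      by (rule sum_lessThan_telescope')
    also have "\<dots> = of_bool (z = u) - of_bool (z = v)"
      using vs len by (auto simp: hd_conv_nth last_conv_nth)
    finally show ?thesis .
  qed
  have flow: "unit_flow G (A - B)" using sub by (auto simp: unit_flow_def inj_on_diff)
  have "net (A - B) z = net A z - net B z" for z
    unfolding net_def using fin BA by (rule sum_diff)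
  then have "net (A - B) z = int j * (of_bool (z = u) - of_bool (z = v))" for z
    by (simp add: Suc.prems(2) netB algebra_simps)
  from Suc.IH[OF flow this] obtain P where
    P: "\<And>i. i < j \<Longrightarrow> path_between G u v (P i)" "\<And>i. i < j \<Longrightarrow> set (P i) \<subseteq> fst ` (A - B)"
      "disjoint_family_on (\<lambda>i. set (P i)) {..<j}" by blast
  have "vs ! i \<in> verts G" if "i < length vs" for i
    using that
  proof (cases i)
    case 0
    then show ?thesis using vs uv by (simp add: hd_conv_nth[symmetric])
  next
    case (Suc l)
    then show ?thesis using RV[of "vs ! l" "vs ! i"] h[of l] len that by (auto simp: R_def)
  qed
  then have "set vs \<subseteq> verts G" by (auto simp: in_set_conv_nth)
  moreover have "set es \<subseteq> edges G" using setes BA sub by (auto simp: arcs_def)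
  moreover have "ends G (es ! i) = {vs ! i, vs ! Suc i}" if "i < n" for i
    using h[OF that] sub that by (auto simp: arcs_def es_def)
  ultimately have path: "path_between G u v es"
    unfolding path_between_def is_path_def using vs len by (intro exI[of _ vs]) (auto simp: es_def)
  \<comment> \<open>Since \<open>fst\<close> is injective on \<open>A\<close>, disjoint sets of arcs
    use disjoint sets of edges.\<close>
  have disj: "fst ` B \<inter> fst ` (A - B) = {}"
    using inj_on_image_set_diff[OF sub(2), of A B] BA by auto
  show ?case
  proof (intro exI[of _ "P(j := es)"] conjI allI impI)
    fix i assume i: "i < Suc j"
    show "path_between G u v ((P(j := es)) i)"
      using i P(1)[of i] path by (cases "i = j") auto
    show "set ((P(j := es)) i) \<subseteq> fst ` A"
    proof (cases "i = j")
      case True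
      then show ?thesis using setes BA by auto
    next
      case False
      then have "set (P i) \<subseteq> fst ` (A - B)" using i P(2) by simp
      then show ?thesis using False by auto
    qed
  next
    have new: "set (P i) \<inter> set es = {}" if "i < j" for i
      using P(2)[OF that] disj unfolding setes by blast
    show "disjoint_family_on (\<lambda>i. set ((P(j := es)) i)) {..<Suc j}"
      unfolding disjoint_family_on_def
    proof (intro ballI impI)
      fix a b assume ab: "a \<in> {..<Suc j}" "b \<in> {..<Suc j}" "a \<noteq> b"
      show "set ((P(j := es)) a) \<inter> set ((P(j := es)) b) = {}"
        using ab new[of a] new[of b] disjoint_family_onD[OF P(3), of a b]
        by (cases "a = j"; cases "b = j") (auto simp: Int_commute)
    qed
  qed
qed

lemma edge_disjoint_paths_cut:
  assumes "finite (edges G)" "edge_disjoint_paths G k u v" "u \<in> X" "v \<notin> X"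
  shows "k \<le> card (edge_cut G X)"
proof -
  obtain P where P: "\<And>i. i < k \<Longrightarrow> path_between G u v (P i)"
    "disjoint_family_on (\<lambda>i. set (P i)) {..<k}"
    using assms(2) by (auto simp: edge_disjoint_paths_def)
  have "\<exists>e. e \<in> set es \<inter> edge_cut G X" if es: "path_between G u v es" for es
  proof -
    obtain vs where vs: "is_path G vs es" "hd vs = u" "last vs = v"
      using es by (auto simp: path_between_def)
    then have len: "length vs = Suc (length es)" and dist: "distinct vs" by (auto simp: is_path_def)
    have "vs ! 0 \<in> X" "vs ! length es \<notin> X"
      using vs len assms by (auto simp: hd_conv_nth last_conv_nth simp flip: length_0_conv)
    then obtain i where i: "i < length es" "vs ! i \<in> X" "vs ! Suc i \<notin> X"
      using ex_least_nat_less[of "\<lambda>i. vs ! i \<notin> X" "length es"] by auto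
    then have "ends G (es ! i) = {vs ! i, vs ! Suc i}" "es ! i \<in> edges G" "vs ! i \<noteq> vs ! Suc i"
      using vs by (auto simp: is_path_def)
    then have "es ! i \<in> edge_cut G X" using i edge_cut_iff by metis
    then show ?thesis using i(1) nth_mem by blast
  qed
  then have "\<forall>i\<in>{..<k}. \<exists>e. e \<in> set (P i) \<inter> edge_cut G X" using P(1) by simp
  then obtain g where "\<forall>i\<in>{..<k}. g i \<in> set (P i) \<inter> edge_cut G X" by (rule bchoice[THEN exE])
  then have g: "\<And>i. i < k \<Longrightarrow> g i \<in> set (P i)" "\<And>i. i < k \<Longrightarrow> g i \<in> edge_cut G X" by auto
  have "inj_on g {..<k}"
  proof (rule inj_onI, rule ccontr)
    fix i j assume ij: "i \<in> {..<k}" "j \<in> {..<k}" "g i = g j" "i \<noteq> j"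
    then show False using g(1)[of i] g(1)[of j] disjoint_family_onD[OF P(2), of i j] by auto
  qed
  then have "card {..<k} \<le> card (edge_cut G X)"
    by (rule card_inj_on_le) (use g assms(1) in \<open>auto simp: edge_cut_def\<close>)
  then show ?thesis by simp
qed

theorem Menger_edge:
  assumes "finite_loopless_multigraph G" "u \<in> verts G" "v \<in> verts G" "u \<noteq> v"
  shows "edge_disjoint_paths G k u v \<longleftrightarrow>
    (\<forall>X\<subseteq>verts G. u \<in> X \<longrightarrow> v \<notin> X \<longrightarrow> k \<le> card (edge_cut G X))"
proof
  assume "edge_disjoint_paths G k u v"
  then show "\<forall>X\<subseteq>verts G. u \<in> X \<longrightarrow> v \<notin> X \<longrightarrow> k \<le> card (edge_cut G X)"
    using edge_disjoint_paths_cut assms(1) by (metis finite_loopless_multigraph_def)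
next
  assume "\<forall>X\<subseteq>verts G. u \<in> X \<longrightarrow> v \<notin> X \<longrightarrow> k \<le> card (edge_cut G X)"
  then obtain A where "unit_flow G A" "\<forall>z. net A z = int k * (of_bool (z = u) - of_bool (z = v))"
    using unit_flow_exists[OF assms, of k k] by auto
  then show "edge_disjoint_paths G k u v"
    using unit_flow_paths[OF assms(1,2,4), of A k] by (auto simp: edge_disjoint_paths_def)
qed

section \<open>The cut form of (s,k)-edge-connectivity\<close>

lemma edge_cut_complement:
  assumes "finite_loopless_multigraph G"
  shows "edge_cut G (verts G - X) = edge_cut G X"
proof (rule set_eqI)
  fix e
  show "e \<in> edge_cut G (verts G - X) \<longleftrightarrow> e \<in> edge_cut G X"
  proof (cases "e \<in> edges G")
    case True
    then obtain x y where "ends G e = {x, y}" "x \<noteq> y" "x \<in> verts G" "y \<in> verts G"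
      by (rule edge_ends[OF assms])
    then show ?thesis by (auto simp: edge_cut_iff)
  qed (simp add: edge_cut_def)
qed

text \<open>Every cut is represented by its side avoiding \<open>s\<close>. As paths may pass
  through \<open>s\<close>, cuts are taken in all of \<open>G\<close>; the side
  \<open>verts G - {s}\<close> is left out because it separates no two vertices different from
  \<open>s\<close>.\<close>

lemma sk_edge_connected_iff_cuts:
  assumes G: "finite_loopless_multigraph G"
  shows "sk_edge_connected G s k \<longleftrightarrow> card (verts G) \<ge> 3 \<and> s \<in> verts G \<and> k > 0 \<and>
    (\<forall>X\<subseteq>verts G - {s}. X \<noteq> {} \<longrightarrow> X \<noteq> verts G - {s} \<longrightarrow> k \<le> card (edge_cut G X))"
    (is "_ \<longleftrightarrow> _ \<and> _ \<and> _ \<and> ?cuts")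
proof -
  have "(\<forall>u\<in>verts G - {s}. \<forall>v\<in>verts G - {s}. u \<noteq> v \<longrightarrow> edge_disjoint_paths G k u v) \<longleftrightarrow> ?cuts"
    (is "?paths \<longleftrightarrow> _")
  proof
    assume paths: ?paths
    show ?cuts
    proof (intro allI impI)
      fix X assume X: "X \<subseteq> verts G - {s}" "X \<noteq> {}" "X \<noteq> verts G - {s}"
      then obtain u v where uv: "u \<in> X" "v \<in> verts G - {s}" "v \<notin> X" by blast
      then have "edge_disjoint_paths G k u v" using paths X(1) by (metis subsetD)
      then show "k \<le> card (edge_cut G X)"
        by (rule edge_disjoint_paths_cut[rotated])
          (use uv G in \<open>simp_all add: finite_loopless_multigraph_def\<close>)
    qed
  next
    assume cuts: ?cuts
    show ?paths
    proof (intro ballI impI)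
      fix u v assume uv: "u \<in> verts G - {s}" "v \<in> verts G - {s}" "u \<noteq> v"
      have "k \<le> card (edge_cut G X)" if X: "X \<subseteq> verts G" "u \<in> X" "v \<notin> X" for X
      proof (cases "s \<in> X")
        case True
        then have "k \<le> card (edge_cut G (verts G - X))" using cuts X uv by blast
        then show ?thesis by (simp add: edge_cut_complement[OF G])
      next
        case False
        then show ?thesis using cuts X uv by blast
      qed
      then show "edge_disjoint_paths G k u v" using Menger_edge[OF G] uv by auto
    qed
  qed
  then show ?thesis by (auto simp: sk_edge_connected_def)
qed

section \<open>Edges between vertex sets\<close>

definition between :: "('v, 'e) mgraph \<Rightarrow> 'v set \<Rightarrow> 'v set \<Rightarrow> 'e set" where
  "between G X Y = {e \<in> edges G. \<exists>x\<in>X. \<exists>y\<in>Y. ends G e = {x, y}}"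

lemma between_commute: "between G X Y = between G Y X"
  unfolding between_def by (metis insert_commute)

lemma between_Un_left: "between G (A \<union> B) C = between G A C \<union> between G B C"
  by (auto simp: between_def)

lemma between_mono: "A \<subseteq> A' \<Longrightarrow> B \<subseteq> B' \<Longrightarrow> between G A B \<subseteq> between G A' B'"
  unfolding between_def by blast

lemma edge_cut_eq_between:
  assumes "finite_loopless_multigraph G"
  shows "edge_cut G X = between G X (verts G - X)"
proof (rule set_eqI)
  fix e
  show "e \<in> edge_cut G X \<longleftrightarrow> e \<in> between G X (verts G - X)"
  proof (cases "e \<in> edges G")
    case True
    then obtain x y where xy: "ends G e = {x, y}" "x \<noteq> y" "x \<in> verts G" "y \<in> verts G"
      by (rule edge_ends[OF assms])
    have "e \<in> between G X (verts G - X) \<longleftrightarrow> (x \<in> X \<and> y \<notin> X \<or> y \<in> X \<and> x \<notin> X)"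
      using True xy(3,4) unfolding between_def mem_Collect_eq xy(1) doubleton_eq_iff by blast
    then show ?thesis using True unfolding edge_cut_iff[OF xy(1,2)] by blast
  qed (simp add: edge_cut_def between_def)
qed

section \<open>Cut sizes as sums of edge counts between cells\<close>

locale finite_multigraph =
  fixes G :: "('v, 'e) mgraph"
  assumes G: "finite_loopless_multigraph G"
begin

definition m :: "'v set \<Rightarrow> 'v set \<Rightarrow> nat" where
  "m X Y = card (between G X Y)"

definition d :: "'v set \<Rightarrow> nat" where
  "d X = card (edge_cut G X)"

lemma finite_between [simp]: "finite (between G X Y)"
  using G by (simp add: between_def finite_loopless_multigraph_def)

lemma m_commute: "m X Y = m Y X"
  by (simp add: m_def between_commute)

lemma m_mono: "A \<subseteq> A' \<Longrightarrow> B \<subseteq> B' \<Longrightarrow> m A B \<le> m A' B'"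
  unfolding m_def by (intro card_mono between_mono) auto

lemma m_Un_left_le: "m (A \<union> B) C \<le> m A C + m B C"
  unfolding m_def between_Un_left by (rule card_Un_le)

lemma m_Un_left:
  assumes "A \<inter> B = {}" "A \<inter> C = {}"
  shows "m (A \<union> B) C = m A C + m B C"
  unfolding m_def between_Un_left
proof (rule card_Un_disjoint)
  show "between G A C \<inter> between G B C = {}"
    using assms by (auto simp: between_def doubleton_eq_iff)
qed auto

lemma m_Un_right:
  assumes "A \<inter> B = {}" "A \<inter> C = {}"
  shows "m C (A \<union> B) = m C A + m C B"
  using m_Un_left[OF assms] by (simp add: m_commute)

lemma m_Union_right_eq_0:
  assumes "\<And>i. i \<in> I \<Longrightarrow> m C (A i) = 0"
  shows "m C (\<Union>i\<in>I. A i) = 0"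
proof -
  have "between G C (\<Union>i\<in>I. A i) = (\<Union>i\<in>I. between G C (A i))"
    by (auto simp: between_def)
  moreover have "between G C (A i) = {}" if "i \<in> I" for i
    using assms[OF that] by (simp add: m_def)
  ultimately show ?thesis by (simp add: m_def)
qed

lemma d_eq_m: "d X = m X (verts G - X)"
  by (simp add: d_def m_def edge_cut_eq_between[OF G])

text \<open>All six cuts are linear in the edge counts between the four cells, so uncrossing becomes
  linear arithmetic. The two consequences used are
  \<open>d X + d Y = d I + d (X \<union> Y) + 2 * m P Q\<close> and
  \<open>d X + d Y = d P + d Q + 2 * m I N\<close>.\<close>

lemma cut_pair:
  fixes X Y
  assumes "X \<subseteq> verts G" "Y \<subseteq> verts G"
  defines "I \<equiv> X \<inter> Y" and "P \<equiv> X - Y" and "Q \<equiv> Y - X" and "N \<equiv> verts G - (X \<union> Y)"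
  shows "d X = m I Q + m I N + m P Q + m P N"
    and "d Y = m I P + m I N + m P Q + m Q N"
    and "d I = m I P + m I Q + m I N"
    and "d (X \<union> Y) = m I N + m P N + m Q N"
    and "d P = m I P + m P Q + m P N"
    and "d Q = m I Q + m P Q + m Q N"
proof -
  have disj: "I \<inter> P = {}" "I \<inter> Q = {}" "I \<inter> N = {}" "P \<inter> Q = {}" "P \<inter> N = {}" "Q \<inter> N = {}"
    "P \<inter> I = {}" "Q \<inter> I = {}" "N \<inter> I = {}" "Q \<inter> P = {}" "N \<inter> P = {}" "N \<inter> Q = {}"
    by (auto simp: I_def P_def Q_def N_def)
  note add = m_Un_left m_Un_right disj Int_Un_distrib Int_Un_distrib2
  have "X = I \<union> P" "verts G - X = Q \<union> N"
    using assms(1,2) by (auto simp: I_def P_def Q_def N_def)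
  then have "d X = m (I \<union> P) (Q \<union> N)" by (simp add: d_eq_m)
  then show "d X = m I Q + m I N + m P Q + m P N" by (simp add: add)
  have "Y = I \<union> Q" "verts G - Y = P \<union> N"
    using assms(1,2) by (auto simp: I_def P_def Q_def N_def)
  then have "d Y = m (I \<union> Q) (P \<union> N)" by (simp add: d_eq_m)
  then show "d Y = m I P + m I N + m P Q + m Q N" by (simp add: add m_commute)
  have "verts G - I = P \<union> (Q \<union> N)"
    using assms(1,2) by (auto simp: I_def P_def Q_def N_def)
  then show "d I = m I P + m I Q + m I N" by (simp add: d_eq_m add)
  have "X \<union> Y = I \<union> (P \<union> Q)" by (auto simp: I_def P_def Q_def)
  then have "d (X \<union> Y) = m (I \<union> (P \<union> Q)) N" by (simp add: d_eq_m N_def)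
  then show "d (X \<union> Y) = m I N + m P N + m Q N" by (simp add: add)
  have "verts G - P = I \<union> (Q \<union> N)"
    using assms(1,2) by (auto simp: I_def P_def Q_def N_def)
  then show "d P = m I P + m P Q + m P N" by (simp add: d_eq_m add m_commute)
  have "verts G - Q = I \<union> (P \<union> N)"
    using assms(1,2) by (auto simp: I_def P_def Q_def N_def)
  then show "d Q = m I Q + m P Q + m Q N" by (simp add: d_eq_m add m_commute)
qed

text \<open>Three overlapping sets give eight cells; there the cuts are compared edge by edge
  instead of through pair counts.\<close>

lemma d_eq_sum: "d X = (\<Sum>e\<in>edges G. of_bool (e \<in> edge_cut G X))"
proof -
  have "edges G \<inter> {e. e \<in> edge_cut G X} = edge_cut G X" by (auto simp: edge_cut_def)
  then show ?thesis using G unfolding d_def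
    by (simp add: finite_loopless_multigraph_def of_bool_def sum.If_cases)
qed

lemma d_two_parts:
  assumes "Z \<subseteq> B" "B \<subseteq> verts G"
  shows "d Z + d (B - Z) = d B + 2 * m Z (B - Z)"
proof -
  have eq: "Z \<union> (B - Z) = B" "Z - (B - Z) = Z" "B - Z - Z = B - Z" "Z \<inter> (B - Z) = {}"
    using assms by auto
  have sub: "Z \<subseteq> verts G" "B - Z \<subseteq> verts G" using assms by auto
  show ?thesis
    using cut_pair[of Z "B - Z", unfolded eq] sub by (simp add: m_def between_def)
qed

end

lemma finite_loopless_induced_subgraph:
  assumes "finite_loopless_multigraph G"
  shows "finite_loopless_multigraph (induced_subgraph G X)"
  using assms unfolding finite_loopless_multigraph_def induced_subgraph_def by auto

section \<open>Dangerous sets\<close>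

locale lifting = finite_multigraph G for G :: "('v, 'e) mgraph" +
  fixes s :: 'v and k :: nat
  assumes sk: "sk_edge_connected G s k" and k2: "k \<ge> 2" and deg: "degree G s > 4"
begin

definition W :: "'v set" where
  "W = verts G - {s}"

definition star :: "'v set \<Rightarrow> 'e set" where
  "star X = {e \<in> incident_edges G s. other_end G s e \<in> X}"

text \<open>Lifting two edges that both end in \<open>X\<close> lowers the cut of \<open>X\<close>
  by two, and \<open>k + 1\<close> is the largest size that drops below \<open>k\<close>.\<close>

definition dangerous :: "'v set \<Rightarrow> bool" where
  "dangerous X \<longleftrightarrow> X \<subseteq> W \<and> X \<noteq> {} \<and> X \<noteq> W \<and> d X \<le> k + 1"

text \<open>A dangerous set forbids a lift only if two edges at \<open>s\<close> end in it.
  Maximality is what keeps the union of two blocks from being dangerous.\<close>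

definition block :: "'v set \<Rightarrow> bool" where
  "block X \<longleftrightarrow> dangerous X \<and> card (star X) \<ge> 2 \<and> (\<forall>Y. dangerous Y \<longrightarrow> X \<subseteq> Y \<longrightarrow> Y = X)"

lemma cuts: "X \<subseteq> W \<Longrightarrow> X \<noteq> {} \<Longrightarrow> X \<noteq> W \<Longrightarrow> k \<le> d X"
  using sk by (simp add: sk_edge_connected_iff_cuts[OF G] d_def W_def)

lemma s_in: "s \<in> verts G" using sk by (simp add: sk_edge_connected_def)

lemma W_sub: "X \<subseteq> W \<Longrightarrow> X \<subseteq> verts G" "X \<subseteq> W \<Longrightarrow> s \<notin> X"
  by (auto simp: W_def)

lemma finite_W: "finite W" using G by (simp add: W_def finite_loopless_multigraph_def)

lemma incident_ends:
  assumes "e \<in> incident_edges G s"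
  shows "ends G e = {s, other_end G s e}" "other_end G s e \<in> W" "e \<in> edges G"
proof -
  have e: "e \<in> edges G" "s \<in> ends G e" using assms by (auto simp: incident_edges_def)
  obtain x y where xy: "ends G e = {x, y}" "x \<noteq> y" "x \<in> verts G" "y \<in> verts G"
    by (rule edge_ends[OF G e(1)])
  obtain v where v: "ends G e = {s, v}" "v \<noteq> s" "v \<in> verts G"
  proof (cases "x = s")
    case True
    then show ?thesis using xy that by auto
  next
    case False
    then have "y = s" using e(2) xy(1) by auto
    then show ?thesis using xy that[of x] by (auto simp: insert_commute)
  qed
  then have "ends G e - {s} = {v}" by auto
  then have "other_end G s e = v" by (simp add: other_end_def)
  then show "ends G e = {s, other_end G s e}" "other_end G s e \<in> W" "e \<in> edges G"
    using v e by (auto simp: W_def)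
qed

lemma star_Int: "star (X \<inter> Y) = star X \<inter> star Y"
  and star_Un: "star (X \<union> Y) = star X \<union> star Y"
  and star_Diff: "star (X - Y) = star X - star Y"
  and star_empty [simp]: "star {} = {}"
  by (auto simp: star_def)

lemma star_mono: "X \<subseteq> Y \<Longrightarrow> star X \<subseteq> star Y" by (auto simp: star_def)

lemma star_W: "star W = incident_edges G s"
  by (auto simp: star_def dest: incident_ends)

lemma star_subset: "star X \<subseteq> incident_edges G s" by (auto simp: star_def)

lemma finite_incident: "finite (incident_edges G s)"
  using G by (simp add: incident_edges_def finite_loopless_multigraph_def)

lemma finite_star [simp]: "finite (star X)"
  using finite_subset[OF star_subset finite_incident] .

lemma star_eq_between:
  assumes "X \<subseteq> W"
  shows "star X = between G X {s}"
proof (rule set_eqI)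
  fix e
  show "e \<in> star X \<longleftrightarrow> e \<in> between G X {s}"
  proof (cases "e \<in> incident_edges G s")
    case True
    note e = incident_ends[OF True]
    have "s \<notin> X" using W_sub(2)[OF assms] .
    then have "(\<exists>x\<in>X. \<exists>y\<in>{s}. ends G e = {x, y}) \<longleftrightarrow> other_end G s e \<in> X"
      unfolding e(1) doubleton_eq_iff by blast
    then show ?thesis using True e(3) by (simp add: star_def between_def)
  qed (auto simp: star_def between_def incident_edges_def)
qed

lemma card_star: "X \<subseteq> W \<Longrightarrow> card (star X) = m X {s}"
  by (simp add: star_eq_between m_def)

lemma d_split_s:
  assumes "X \<subseteq> W"
  shows "d X = m X (W - X) + card (star X)"
proof -
  have "verts G - X = (W - X) \<union> {s}" using assms s_in by (auto simp: W_def)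
  then have "d X = m X (W - X) + m X {s}"
    by (simp add: d_eq_m del: Un_insert_right) (rule m_Un_right, auto simp: W_def)
  then show ?thesis using card_star[OF assms] by simp
qed

lemma d_complement:
  assumes "X \<subseteq> W"
  shows "d (W - X) + 2 * card (star X) = d X + degree G s"
proof -
  have "card (star (W - X)) + card (star X) = degree G s"
    using star_subset[of X] finite_incident
    by (simp add: star_Diff star_W degree_def card_Diff_subset card_mono)
  moreover have "W - (W - X) = X" using assms by auto
  ultimately show ?thesis
    using d_split_s[OF assms] d_split_s[of "W - X"] m_commute[of X "W - X"] by simp
qed

text \<open>This is \<open>k \<le> d (W - X)\<close> rewritten. A dangerous set thus holds at most
  \<open>(deg(s) + 1) / 2\<close> edges at \<open>s\<close>, a set with cut \<open>k + 2\<close> at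
  most \<open>(deg(s) + 2) / 2\<close>.\<close>

lemma star_bound:
  assumes "X \<subseteq> W" "X \<noteq> {}" "X \<noteq> W"
  shows "2 * card (star X) + k \<le> d X + degree G s"
proof -
  have "W - X \<noteq> {}" "W - X \<noteq> W" using assms by blast+
  then show ?thesis using d_complement[OF assms(1)] cuts[of "W - X"] by auto
qed

section \<open>Uncrossing pairs and triples of blocks\<close>

lemma blockD:
  assumes "block X"
  shows "X \<subseteq> W" "X \<noteq> {}" "X \<noteq> W" "d X \<le> k + 1" "card (star X) \<ge> 2"
    and "\<And>Y. dangerous Y \<Longrightarrow> X \<subseteq> Y \<Longrightarrow> Y = X"
  using assms unfolding block_def dangerous_def by simp_all

lemma dangerous_imp_block:
  assumes "dangerous X" "card (star X) \<ge> 2"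
  obtains Y where "block Y" "X \<subseteq> Y"
proof -
  have "{Y. dangerous Y} \<subseteq> Pow W" by (auto simp: dangerous_def)
  then have "finite {Y. dangerous Y}" using finite_W by (meson finite_Pow_iff finite_subset)
  then obtain Y where Y: "dangerous Y" "X \<subseteq> Y" "\<forall>Z\<in>{Y. dangerous Y}. Y \<subseteq> Z \<longrightarrow> Y = Z"
    using finite_has_maximal2[of "{Y. dangerous Y}" X] assms by auto
  then have "card (star Y) \<ge> 2" using assms(2) card_mono[OF finite_star star_mono] le_trans by metis
  then show ?thesis using that Y by (auto simp: block_def)
qed

lemma block_Diff:
  assumes "block X" "block Y" "X \<noteq> Y"
  shows "X - Y \<noteq> {}" "X - Y \<subseteq> W" "X - Y \<noteq> W"
proof -
  show "X - Y \<noteq> {}" using blockD(6)[OF assms(1), of Y] assms by (auto simp: block_def)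
  show "X - Y \<subseteq> W" "X - Y \<noteq> W" using blockD(1-3)[OF assms(1)] by auto
qed

text \<open>The count \<open>d X + d Y = d (X - Y) + d (Y - X) + 2 m\<close>, where \<open>m\<close> is the number of edges
  leaving \<open>X \<union> Y\<close> from \<open>X \<inter> Y\<close>, is tight as soon as one of these edges ends in \<open>s\<close>.\<close>

lemma share:
  assumes "block X" "block Y" "X \<noteq> Y" "p \<in> star X" "p \<in> star Y"
  shows "d X = k + 1" "d Y = k + 1" "d (X - Y) = k" "d (Y - X) = k"
    and "star X \<inter> star Y = {p}" "m (X \<inter> Y) (verts G - (X \<union> Y)) = 1"
proof -
  note X = blockD[OF assms(1)] and Y = blockD[OF assms(2)]
  let ?N = "verts G - (X \<union> Y)"
  have P: "k \<le> d (X - Y)" using block_Diff[OF assms(1,2)] assms(3) cuts by blast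
  have Q: "k \<le> d (Y - X)" using block_Diff[OF assms(2,1)] assms(3) cuts by blast
  have "m (X \<inter> Y) {s} \<le> m (X \<inter> Y) ?N"
    using s_in W_sub[OF X(1)] W_sub[OF Y(1)] by (intro m_mono) auto
  moreover have "card (star (X \<inter> Y)) = m (X \<inter> Y) {s}" using X(1) by (intro card_star) auto
  ultimately have le: "card (star X \<inter> star Y) \<le> m (X \<inter> Y) ?N" by (simp add: star_Int)
  have sub: "{p} \<subseteq> star X \<inter> star Y" using assms by simp
  then have ge: "1 \<le> card (star X \<inter> star Y)" using card_mono[OF _ sub] by simp
  note cp = cut_pair[OF W_sub(1)[OF X(1)] W_sub(1)[OF Y(1)]]
  show "d X = k + 1" "d Y = k + 1" "d (X - Y) = k" "d (Y - X) = k"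
    and one: "m (X \<inter> Y) ?N = 1"
    using cp(1,2,5,6) P Q X(4) Y(4) le ge by linarith+
  have "card (star X \<inter> star Y) = card {p}" using le ge one by simp
  then show "star X \<inter> star Y = {p}" using card_subset_eq[OF _ sub] by simp
qed

lemma block_eqI:
  assumes "block X" "block Y" "p \<in> star X" "p \<in> star Y" "q \<in> star X" "q \<in> star Y" "p \<noteq> q"
  shows "X = Y"
proof (rule ccontr)
  assume "X \<noteq> Y"
  then have "star X \<inter> star Y = {p}" using share(5)[OF assms(1,2) _ assms(3,4)] by simp
  then show False using assms(5-7) by auto
qed

text \<open>By maximality the cut of \<open>X \<union> Y\<close> is at least \<open>k + 2\<close>,
  and that of \<open>X \<inter> Y\<close> at least \<open>k\<close>. These add up to
  \<open>d X + d Y = 2 k + 2\<close>, so both are attained and no edge joins \<open>X - Y\<close> to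
  \<open>Y - X\<close>. Comparing \<open>d X = k + 1\<close> with \<open>d (X - Y) = k\<close> shows
  that \<open>X \<inter> Y\<close> sends equally many edges to both sides; with the single edge to
  \<open>s\<close> this makes \<open>k\<close> odd.\<close>

lemma share_proper:
  assumes "block X" "block Y" "X \<noteq> Y" "p \<in> star X" "p \<in> star Y" "X \<union> Y \<noteq> W"
  shows "odd k" "d (X \<inter> Y) = k" "d (X \<union> Y) = k + 2"
    and "m (X \<inter> Y) (X - Y) = k div 2" "m (X \<inter> Y) (Y - X) = k div 2"
proof -
  note X = blockD[OF assms(1)] and Y = blockD[OF assms(2)]
  note sh = share[OF assms(1-5)]
  have "star (X \<inter> Y) \<noteq> {}" using assms by (auto simp: star_Int)
  then have ne: "X \<inter> Y \<noteq> {}" by auto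
  have I: "k \<le> d (X \<inter> Y)" using ne X by (intro cuts) auto
  have "\<not> dangerous (X \<union> Y)"
    using X(6)[of "X \<union> Y"] Y(6)[of "X \<union> Y"] assms(3) by auto
  then have U: "k + 2 \<le> d (X \<union> Y)"
    using X(1,2) Y(1) assms(6) by (auto simp: dangerous_def)
  note cp = cut_pair[OF W_sub(1)[OF X(1)] W_sub(1)[OF Y(1)]]
  show "d (X \<inter> Y) = k" "d (X \<union> Y) = k + 2"
    using cp(1-4) sh I U by linarith+
  have eq: "m (X \<inter> Y) (X - Y) = m (X \<inter> Y) (Y - X)" "k = 2 * m (X \<inter> Y) (X - Y) + 1"
    using cp sh I U by linarith+
  then show "odd k" "m (X \<inter> Y) (X - Y) = k div 2" "m (X \<inter> Y) (Y - X) = k div 2" by presburger+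
qed

text \<open>The triple intersection and the three private parts have cuts of size at least
  \<open>k\<close>. The edge \<open>p\<close> is counted once by these four cuts but three times by
  \<open>X\<close>, \<open>Y\<close> and \<open>Z\<close>, which yields the extra 2 and thus
  \<open>4 k + 2 \<le> 3 (k + 1)\<close>, impossible for \<open>k \<ge> 2\<close>.\<close>

lemma no_triple:
  assumes "block X" "block Y" "block Z" "p \<in> star X" "p \<in> star Y" "p \<in> star Z"
  shows "X = Y \<or> Y = Z \<or> X = Z"
proof (rule ccontr)
  assume neq: "\<not> ?thesis"
  note X = blockD[OF assms(1)] and Y = blockD[OF assms(2)] and Z = blockD[OF assms(3)]
  let ?I = "X \<inter> Y \<inter> Z"
  have priv: "k \<le> d (A - (B \<union> C))"
    if "block A" "block B" "block C" "A \<noteq> B" "A \<noteq> C" "p \<in> star A" "p \<in> star B" "p \<in> star C" for A B C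
  proof -
    have "star A \<inter> star B = {p}" by (rule share(5)[OF that(1,2,4,6,7)])
    moreover have "star A \<inter> star C = {p}" by (rule share(5)[OF that(1,3,5,6,8)])
    \<comment> \<open>Each block has a second edge at \<open>s\<close>, which no other block through
      \<open>p\<close> can share; it ends in the private part.\<close>
    moreover have "star A \<noteq> {p}" using blockD(5)[OF that(1)] by auto
    ultimately have "star (A - (B \<union> C)) \<noteq> {}"
      using that(6) unfolding star_Diff star_Un by blast
    then have "A - (B \<union> C) \<noteq> {}" by (metis star_empty)
    then show ?thesis using blockD[OF that(1)] by (intro cuts) auto
  qed
  have ps: "p \<in> star ?I" using assms by (simp add: star_Int)
  then have "?I \<noteq> {}" by auto
  then have I: "k \<le> d ?I" using X by (intro cuts) auto
  have "d ?I + d (X - (Y \<union> Z)) + d (Y - (X \<union> Z)) + d (Z - (X \<union> Y)) + 2 * card {p}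
    \<le> d X + d Y + d Z"
  proof -
    have fin: "finite (edges G)" using G by (simp add: finite_loopless_multigraph_def)
    have "p \<in> edges G" using ps incident_ends(3) by (auto simp: star_def)
    then have p: "card {p} = (\<Sum>e\<in>edges G. of_bool (e = p))"
      using fin by (simp add: of_bool_def)
    show ?thesis
      unfolding d_eq_sum p sum_distrib_left sum.distrib[symmetric]
    proof (rule sum_mono)
      fix e assume e: "e \<in> edges G"
      obtain x y where xy: "ends G e = {x, y}" "x \<noteq> y" by (rule edge_ends[OF G e])
      have "e = p \<Longrightarrow> x = s \<and> y \<in> ?I \<or> y = s \<and> x \<in> ?I"
      proof -
        assume [simp]: "e = p"
        have "{x, y} = {s, other_end G s p}" "other_end G s p \<in> ?I"
          using ps xy(1) incident_ends(1)[of p] unfolding star_def by auto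
        then show ?thesis unfolding doubleton_eq_iff by blast
      qed
      moreover have "s \<notin> X" "s \<notin> Y" "s \<notin> Z" using X Y Z by (auto simp: W_def)
      ultimately show "of_bool (e \<in> edge_cut G ?I) + of_bool (e \<in> edge_cut G (X - (Y \<union> Z)))
        + of_bool (e \<in> edge_cut G (Y - (X \<union> Z))) + of_bool (e \<in> edge_cut G (Z - (X \<union> Y)))
        + 2 * of_bool (e = p)
        \<le> (of_bool (e \<in> edge_cut G X) + of_bool (e \<in> edge_cut G Y) + of_bool (e \<in> edge_cut G Z) :: nat)"
        using e unfolding edge_cut_iff[OF xy]
        by (cases "x \<in> X"; cases "x \<in> Y"; cases "x \<in> Z"; cases "y \<in> X"; cases "y \<in> Y"; cases "y \<in> Z";
            cases "e = p") auto
    qed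
  qed
  moreover have "X \<noteq> Y" "Y \<noteq> X" "X \<noteq> Z" "Z \<noteq> X" "Y \<noteq> Z" "Z \<noteq> Y" using neq by blast+
  then have "k \<le> d (X - (Y \<union> Z))" "k \<le> d (Y - (X \<union> Z))" "k \<le> d (Z - (X \<union> Y))"
    by (simp_all add: priv assms)
  moreover have "card {p} = 1" by simp
  ultimately show False using I X(4) Y(4) Z(4) k2 by linarith
qed

text \<open>Otherwise the \<open>k\<close> edges leaving \<open>A \<inter> B\<close> would go in equal numbers to \<open>A - B\<close> and \<open>B - A\<close>,
  contradicting the parity of \<open>k\<close>.\<close>

lemma tight_disjoint:
  assumes "A \<subseteq> W" "B \<subseteq> W" "d A = k" "d B = k" "odd k" "A - B \<noteq> {}" "B - A \<noteq> {}" "A \<union> B \<noteq> W"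
  shows "A \<inter> B = {}"
proof (rule ccontr)
  assume ne: "A \<inter> B \<noteq> {}"
  have "k \<le> d (A \<inter> B)" by (rule cuts) (use assms ne in blast)+
  moreover have "k \<le> d (A \<union> B)" by (rule cuts) (use assms ne in blast)+
  moreover have "k \<le> d (A - B)" by (rule cuts) (use assms ne in blast)+
  moreover have "k \<le> d (B - A)" by (rule cuts) (use assms ne in blast)+
  ultimately have "m (A \<inter> B) (A - B) = m (A \<inter> B) (B - A)" "k = 2 * m (A \<inter> B) (A - B)"
    using cut_pair[OF W_sub(1)[OF assms(1)] W_sub(1)[OF assms(2)]] assms(3,4) by linarith+
  then show False using assms(5) by presburger
qed

text \<open>For a proper part \<open>Z\<close> of \<open>B\<close>, the cuts of \<open>Z\<close> and
  \<open>B - Z\<close> have at least \<open>2 k\<close> edges in total. Those inside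
  \<open>B\<close> are counted twice and the others make up \<open>d B = k\<close>, so at least
  \<open>k / 2\<close> run inside \<open>B\<close>.\<close>

lemma edge_connected_tight:
  assumes B: "B \<subseteq> W" "B \<noteq> W" "d B = k"
  shows "edge_connected (nat \<lceil>real k / 2\<rceil>) (induced_subgraph G B)"
  unfolding edge_connected_def
proof (intro ballI impI)
  let ?H = "induced_subgraph G B"
  note H = finite_loopless_induced_subgraph[OF G, of B]
  have BV: "verts ?H = B" using W_sub(1)[OF B(1)] by (auto simp: induced_subgraph_def)
  fix u v assume uv: "u \<in> verts ?H" "v \<in> verts ?H" "u \<noteq> v"
  have "nat \<lceil>real k / 2\<rceil> \<le> card (edge_cut ?H Z)" if Z: "Z \<subseteq> verts ?H" "u \<in> Z" "v \<notin> Z" for Z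
  proof -
    have "between G Z (B - Z) = between ?H Z (B - Z)"
      using Z BV by (auto simp: between_def induced_subgraph_def)
    then have eq: "card (edge_cut ?H Z) = m Z (B - Z)"
      by (simp add: m_def edge_cut_eq_between[OF H] BV)
    have "k \<le> d Z" by (rule cuts) (use Z uv B(1,2) BV in blast)+
    moreover have "k \<le> d (B - Z)" by (rule cuts) (use Z uv B(1,2) BV in blast)+
    ultimately have "k \<le> 2 * m Z (B - Z)"
      using d_two_parts[of Z B] Z BV B W_sub(1)[OF B(1)] by auto
    then have "real k / 2 \<le> real (m Z (B - Z))" by linarith
    then show ?thesis unfolding eq by (simp add: ceiling_le_iff nat_le_iff)
  qed
  then show "edge_disjoint_paths ?H (nat \<lceil>real k / 2\<rceil>) u v"
    using Menger_edge[OF H uv] by blast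
qed

section \<open>Two overlapping blocks that cover \<open>V - s\<close>\<close>

definition special_pair :: "'v set \<Rightarrow> 'v set \<Rightarrow> bool" where
  "special_pair X Y \<longleftrightarrow> block X \<and> block Y \<and> X \<noteq> Y \<and> star X \<inter> star Y \<noteq> {} \<and> X \<union> Y = W"

text \<open>The two stars cover all edges at \<open>s\<close> and overlap in one, so their sizes add
  up to \<open>deg(s) + 1\<close>, while \<open>star_bound\<close> allows each at most half of
  that.\<close>

lemma special_card:
  assumes "special_pair X Y"
  shows "2 * card (star X) = degree G s + 1" "2 * card (star Y) = degree G s + 1"
    and "star X \<union> star Y = incident_edges G s"
proof -
  have XY: "block X" "block Y" "X \<noteq> Y" "X \<union> Y = W" using assms by (auto simp: special_pair_def)
  obtain p where p: "p \<in> star X" "p \<in> star Y" using assms by (auto simp: special_pair_def)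
  show T: "star X \<union> star Y = incident_edges G s" using XY(4) star_W star_Un by metis
  have "card (star X) + card (star Y) = degree G s + 1"
    using card_Un_Int[OF finite_star finite_star, of X Y] share(5)[OF XY(1-3) p] T
    by (simp add: degree_def)
  moreover have "2 * card (star X) \<le> degree G s + 1" "2 * card (star Y) \<le> degree G s + 1"
    using star_bound[of X] star_bound[of Y] blockD[OF XY(1)] blockD[OF XY(2)] by linarith+
  ultimately show "2 * card (star X) = degree G s + 1" "2 * card (star Y) = degree G s + 1"
    by linarith+
qed

text \<open>A third block \<open>Z\<close> would share an edge with \<open>X\<close>, as two edges
  in \<open>star Y\<close> would force \<open>Z = Y\<close>. Since \<open>X\<close> already holds
  \<open>(deg(s) + 1) / 2\<close> edges and \<open>Z\<close> adds at least one, the union exceeds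
  the bound \<open>(deg(s) + 2) / 2\<close>.\<close>

lemma special_blocks:
  assumes sp: "special_pair X Y" and Z: "block Z"
  shows "Z = X \<or> Z = Y"
proof (rule ccontr)
  assume neq: "\<not> ?thesis"
  have XY: "block X" "block Y" "X \<noteq> Y" "X \<union> Y = W" using sp by (auto simp: special_pair_def)
  obtain p where p: "p \<in> star X" "p \<in> star Y" using sp by (auto simp: special_pair_def)
  note c = special_card[OF sp]
  have "\<not> card (star Z) \<le> Suc 0" using blockD(5)[OF Z] by simp
  then obtain a b where ab: "a \<in> star Z" "b \<in> star Z" "a \<noteq> b"
    unfolding card_le_Suc0_iff_eq[OF finite_star] by blast
  have T: "a \<in> star X \<union> star Y" "b \<in> star X \<union> star Y" using ab star_subset c(3) by blast+
  obtain a where a: "a \<in> star Z" "a \<in> star X"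
    using T ab block_eqI[OF Z XY(2), of a b] neq by blast
  have UW: "X \<union> Z \<noteq> W"
  proof
    assume "X \<union> Z = W"
    then have "star X \<union> star Z = incident_edges G s" by (metis star_Un star_W)
    then have "star Y - {p} \<subseteq> star Z"
      using share(5)[OF XY(1-3) p] star_subset[of Y] by blast
    \<comment> \<open>As \<open>deg(s) > 4\<close>, the star of \<open>Y\<close> has at least three
      edges, so \<open>Z\<close> would share two of them.\<close>
    moreover have "\<not> card (star Y - {p}) \<le> Suc 0" using c deg p by (simp add: card_Diff_singleton)
    then obtain u v where "u \<in> star Y - {p}" "v \<in> star Y - {p}" "u \<noteq> v"
      using card_le_Suc0_iff_eq[of "star Y - {p}"] by auto
    ultimately have "Z = Y" using block_eqI[OF Z XY(2), of u v] by blast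
    then show False using neq by blast
  qed
  have XZ: "X \<noteq> Z" using neq by blast
  have "card (star (X \<union> Z)) + 1 = card (star X) + card (star Z)"
    using card_Un_Int[OF finite_star finite_star, of X Z] share(5)[OF XY(1) Z XZ a(2,1)]
    by (simp add: star_Un)
  moreover have "2 * card (star (X \<union> Z)) + k \<le> k + 2 + degree G s"
    using star_bound[of "X \<union> Z"] share_proper(3)[OF XY(1) Z XZ a(2,1) UW] UW
      blockD(1,2)[OF XY(1)] blockD(1)[OF Z] by auto
  ultimately show False using c(1) blockD(5)[OF Z] by linarith
qed

text \<open>With \<open>k = 2 r + 1\<close>, the sets \<open>X \<inter> Y\<close> and
  \<open>Z \<inter> Y\<close> are disjoint and each sends \<open>r + 1\<close> edges out of
  \<open>Y\<close>, which exhausts \<open>d Y = k + 1\<close>. The rest of \<open>Y\<close> could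
  have edges only to these two sets, at most \<open>2 r < k\<close>, so it is empty.\<close>

lemma middle_block:
  assumes blk: "block X" "block Y" "block Z" "X \<noteq> Y" "Z \<noteq> Y"
    and pq: "p \<in> star X" "p \<in> star Y" "q \<in> star Y" "q \<in> star Z" "p \<noteq> q"
    and W: "X \<union> Y \<noteq> W" "Z \<union> Y \<noteq> W"
  shows "star Y = {p, q}" "Y = (X \<inter> Y) \<union> (Y \<inter> Z)"
proof -
  note Y = blockD[OF blk(2)]
  let ?A = "X \<inter> Y" and ?B = "Z \<inter> Y"
  define r where "r = k div 2"
  note sX = share[OF blk(1,2,4) pq(1,2)] share_proper[OF blk(1,2,4) pq(1,2) W(1), folded r_def]
  note sZ = share[OF blk(3,2,5) pq(4,3)] share_proper[OF blk(3,2,5) pq(4,3) W(2), folded r_def]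
  have k: "k = 2 * r + 1" using sX(7) by (simp add: r_def)
  have stA: "star ?A = {p}" and stB: "star ?B = {q}" using sX(5) sZ(5) by (auto simp: star_Int)
  have "star (?A - ?B) \<noteq> {}" "star (?B - ?A) \<noteq> {}"
    using stA stB pq(5) by (auto simp: star_Diff)
  then have "?A - ?B \<noteq> {}" "?B - ?A \<noteq> {}" by (metis star_empty)+
  then have disj: "?A \<inter> ?B = {}"
    using sX(7,8) sZ(8) Y by (intro tight_disjoint) auto
  define C where "C = Y - (?A \<union> ?B)"
  have outA: "m ?A (verts G - Y) = r + 1"
  proof -
    have "verts G - Y = (X - Y) \<union> (verts G - (X \<union> Y))"
      using W_sub(1)[OF blockD(1)[OF blk(1)]] by auto
    then have "m ?A (verts G - Y) = m ?A (X - Y) + m ?A (verts G - (X \<union> Y))"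
      by (simp only:) (rule m_Un_right, auto)
    then show ?thesis using sX by simp
  qed
  have outB: "m ?B (verts G - Y) = r + 1"
  proof -
    have "verts G - Y = (Z - Y) \<union> (verts G - (Z \<union> Y))"
      using W_sub(1)[OF blockD(1)[OF blk(3)]] by auto
    then have "m ?B (verts G - Y) = m ?B (Z - Y) + m ?B (verts G - (Z \<union> Y))"
      by (simp only:) (rule m_Un_right, auto)
    then show ?thesis using sZ by simp
  qed
  have "d Y = m ?A (verts G - Y) + m (?B \<union> C) (verts G - Y)"
  proof -
    have "Y = ?A \<union> (?B \<union> C)" by (auto simp: C_def)
    then have "d Y = m (?A \<union> (?B \<union> C)) (verts G - Y)" by (metis d_eq_m)
    also have "\<dots> = m ?A (verts G - Y) + m (?B \<union> C) (verts G - Y)"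
      using disj by (intro m_Un_left) (auto simp: C_def)
    finally show ?thesis .
  qed
  moreover have "m (?B \<union> C) (verts G - Y) = m ?B (verts G - Y) + m C (verts G - Y)"
    by (intro m_Un_left) (auto simp: C_def)
  ultimately have outC: "m C (verts G - Y) = 0" using outA outB sX(2) k by simp
  have "C = {}"
  proof (rule ccontr)
    assume "C \<noteq> {}"
    then have "k \<le> d C" using Y by (intro cuts) (auto simp: C_def)
    also have "verts G - C = (verts G - Y) \<union> (?A \<union> ?B)"
      using W_sub(1)[OF Y(1)] by (auto simp: C_def)
    then have "d C = m ((verts G - Y) \<union> (?A \<union> ?B)) C" by (simp add: d_eq_m m_commute)
    also have "\<dots> \<le> m (verts G - Y) C + (m ?A C + m ?B C)"
      using m_Un_left_le[of "verts G - Y" "?A \<union> ?B" C] m_Un_left_le[of ?A ?B C] by linarith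
    also have "m ?A C \<le> m ?A (Y - X)" "m ?B C \<le> m ?B (Y - Z)"
      by (intro m_mono; auto simp: C_def)+
    ultimately show False using outC sX sZ k by (simp add: m_commute)
  qed
  then show eq: "Y = (X \<inter> Y) \<union> (Y \<inter> Z)" by (auto simp: C_def)
  have "star Y = star ?A \<union> star ?B" using eq star_Un by (metis Int_commute)
  then show "star Y = {p, q}" using stA stB by auto
qed

end

section \<open>Chains of blocks\<close>

text \<open>Blocks \<open>X\<close> are abstract indices of the sets \<open>K X\<close>. Both alternatives come from one longest
  chain of consecutively meeting blocks; by maximality no block outside of it can meet it.\<close>

lemma chain_structure:
  fixes K :: "'b \<Rightarrow> 'a set" and \<B> :: "'b set" and T :: "'a set"
  assumes fin: "finite \<B>" and ne: "\<B> \<noteq> {}"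
    and sub: "\<And>X. X \<in> \<B> \<Longrightarrow> K X \<subseteq> T" and proper: "\<And>X. X \<in> \<B> \<Longrightarrow> K X \<noteq> T"
    and nonempty: "\<And>X. X \<in> \<B> \<Longrightarrow> K X \<noteq> {}"
    and lin: "\<And>X Y a b. X \<in> \<B> \<Longrightarrow> Y \<in> \<B> \<Longrightarrow> a \<in> K X \<Longrightarrow> a \<in> K Y \<Longrightarrow> b \<in> K X \<Longrightarrow> b \<in> K Y \<Longrightarrow>
      X \<noteq> Y \<Longrightarrow> a = b"
    and tri: "\<And>X Y Z p. X \<in> \<B> \<Longrightarrow> Y \<in> \<B> \<Longrightarrow> Z \<in> \<B> \<Longrightarrow> p \<in> K X \<Longrightarrow> p \<in> K Y \<Longrightarrow> p \<in> K Z \<Longrightarrow>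
      X = Y \<or> Y = Z \<or> X = Z"
    and mid: "\<And>X Y Z p q. X \<in> \<B> \<Longrightarrow> Y \<in> \<B> \<Longrightarrow> Z \<in> \<B> \<Longrightarrow> X \<noteq> Y \<Longrightarrow> Z \<noteq> Y \<Longrightarrow>
      p \<in> K X \<Longrightarrow> p \<in> K Y \<Longrightarrow> q \<in> K Y \<Longrightarrow> q \<in> K Z \<Longrightarrow> p \<noteq> q \<Longrightarrow> K Y = {p, q}"
    and conn: "\<And>U. U \<subseteq> T \<Longrightarrow> U \<noteq> {} \<Longrightarrow> U \<noteq> T \<Longrightarrow> \<exists>X\<in>\<B>. K X \<inter> U \<noteq> {} \<and> \<not> K X \<subseteq> U"
  obtains (path) n X p where "n \<ge> 2" "X ` {..<n} = \<B>" "inj_on X {..<n}" "inj_on p {..<n - 1}"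
      "\<And>i. Suc i < n \<Longrightarrow> p i \<in> K (X i) \<inter> K (X (Suc i))"
      "\<And>i. Suc (Suc i) < n \<Longrightarrow> K (X (Suc i)) = {p i, p (Suc i)}"
      "n \<ge> 3 \<Longrightarrow> K (X 0) \<inter> K (X (n - 1)) = {}"
      "T = (\<Union>i<n. K (X i))"
  | (cycle) n X p where "n \<ge> 3" "X ` {..<n} = \<B>" "inj_on X {..<n}" "inj_on p {..<n}"
      "\<And>i. i < n \<Longrightarrow> p i \<in> K (X i) \<inter> K (X (Suc i mod n))"
      "\<And>i. i < n \<Longrightarrow> K (X (Suc i mod n)) = {p i, p (Suc i mod n)}"
      "T = p ` {..<n}"
proof -
  define meets where "meets = (\<lambda>X Y. K X \<inter> K Y \<noteq> {})"
  define chain where "chain = (\<lambda>xs. set xs \<subseteq> \<B> \<and> distinct xs \<and> successively meets xs)"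
  obtain X0 where X0: "X0 \<in> \<B>" using ne by blast
  \<comment> \<open>No single block covers \<open>T\<close>, so some block meets \<open>K X0\<close>
    without lying in it, and chains of length two exist.\<close>
  then obtain Y0 where Y0: "Y0 \<in> \<B>" "K Y0 \<inter> K X0 \<noteq> {}" "\<not> K Y0 \<subseteq> K X0"
    using conn[of "K X0"] sub proper nonempty by blast
  then have c2: "chain [X0, Y0]" using X0 by (auto simp: chain_def meets_def)
  have bound: "length xs < Suc (card \<B>)" if "chain xs" for xs
    using that card_mono[OF fin, of "set xs"] by (simp add: chain_def distinct_card)
  obtain xs where xs: "chain xs" and max: "\<And>ys. chain ys \<Longrightarrow> length ys \<le> length xs"
    using ex_has_greatest_nat[of chain, OF c2, of length "Suc (card \<B>)"] bound by auto
  define n where "n = length xs"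
  define X where "X = (\<lambda>i. xs ! i)"
  have n2: "n \<ge> 2" using max[OF c2] by (simp add: n_def)
  have set_xs: "set xs = X ` {..<n}" by (auto simp: X_def n_def set_conv_nth)
  have XB: "X i \<in> \<B>" if "i < n" for i using xs that by (auto simp: chain_def X_def n_def)
  have X_eq: "X i = X j \<longleftrightarrow> i = j" if "i < n" "j < n" for i j
    using xs that by (auto simp: chain_def X_def n_def nth_eq_iff_index_eq)
  have inj: "inj_on X {..<n}" by (rule inj_onI) (simp add: X_eq)
  have "\<forall>i. \<exists>q. Suc i < n \<longrightarrow> q \<in> K (X i) \<inter> K (X (Suc i))"
    using xs unfolding chain_def successively_conv_nth meets_def X_def n_def by blast
  then obtain p where p: "\<And>i. Suc i < n \<Longrightarrow> p i \<in> K (X i) \<inter> K (X (Suc i))" by metis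
  have tri': "i = j \<or> j = l \<or> i = l"
    if "i < n" "j < n" "l < n" "q \<in> K (X i)" "q \<in> K (X j)" "q \<in> K (X l)" for i j l q
    using tri[OF XB XB XB that(4-6)] that(1-3) X_eq by auto
  \<comment> \<open>Equal joints would put one element into the three blocks \<open>X i\<close>,
    \<open>X (Suc i)\<close> and \<open>X (Suc j)\<close>.\<close>
  have p_neq: "p i \<noteq> p j" if "i < j" "Suc j < n" for i j
  proof
    assume eq: "p i = p j"
    have "p i \<in> K (X i)" "p i \<in> K (X (Suc i))" using p[of i] that by auto
    moreover have "p i \<in> K (X (Suc j))" using p[of j] that eq by auto
    ultimately show False using tri'[of i "Suc i" "Suc j" "p i"] that by auto
  qed
  have injp: "inj_on p {..<n - 1}"
  proof (rule inj_onI, rule ccontr)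
    fix i j assume ij: "i \<in> {..<n - 1}" "j \<in> {..<n - 1}" "p i = p j" "i \<noteq> j"
    then have "Suc i < n" "Suc j < n" by auto
    then show False using ij p_neq[of i j] p_neq[of j i] by (cases i j rule: linorder_cases) auto
  qed
  have inner: "K (X (Suc i)) = {p i, p (Suc i)}" if "Suc (Suc i) < n" for i
  proof (rule mid[of "X i" _ "X (Suc (Suc i))"])
    show "p i \<noteq> p (Suc i)" using p_neq[of i "Suc i"] that by simp
    show "X i \<noteq> X (Suc i)" "X (Suc (Suc i)) \<noteq> X (Suc i)" using X_eq that by auto
  qed (use XB p[of i] p[of "Suc i"] that in auto)
  \<comment> \<open>A block meeting an end of the chain would extend it. An inner block consists of
    two joints only, and \<open>tri\<close> excludes a third block through a joint.\<close>
  have closed: "Y \<in> set xs" if Y: "Y \<in> \<B>" and i: "i < n" and q: "q \<in> K (X i)" "q \<in> K Y" for Y i q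
  proof (rule ccontr)
    assume out: "Y \<notin> set xs"
    then have Yneq: "Y \<noteq> X j" if "j < n" for j using that by (auto simp: set_xs)
    have at_p: False if "Suc j < n" "q = p j" for j
      using tri[of Y "X j" "X (Suc j)" q] p[of j] q(2) Y XB[of j] XB[of "Suc j"] Yneq[of j]
        Yneq[of "Suc j"] X_eq[of j "Suc j"] that by auto
    consider "i = 0" | "i = n - 1" | j where "i = Suc j" "Suc (Suc j) < n"
      using i by (cases i) (auto, linarith)
    then show False
    proof cases
      case 1
      have "chain (Y # xs)"
        using xs out Y q 1 n2 unfolding chain_def
        by (auto simp: successively_Cons meets_def X_def hd_conv_nth n_def)
      then show False using max by fastforce
    next
      case 2
      have "xs \<noteq> []" using n2 by (auto simp: n_def)
      then have "chain (xs @ [Y])"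
        using xs out Y q 2 unfolding chain_def
        by (auto simp: successively_append_iff meets_def X_def last_conv_nth n_def)
      then show False using max by fastforce
    next
      case (3 j)
      then show False using inner[of j] q(1) at_p[of j] at_p[of "Suc j"] by auto
    qed
  qed
  define U where "U = (\<Union>i<n. K (X i))"
  have inU: "Y \<in> set xs" if "Y \<in> \<B>" "K Y \<inter> U \<noteq> {}" for Y
    using that closed by (auto simp: U_def)
  have sub_U: "K Y \<subseteq> U" if "Y \<in> set xs" for Y using that by (auto simp: set_xs U_def)
  \<comment> \<open>Otherwise \<open>conn\<close> yields a block crossing \<open>U\<close>; it meets
    the chain, hence belongs to it and lies inside \<open>U\<close>.\<close>
  have UT: "U = T"
  proof (rule ccontr)
    assume "U \<noteq> T"
    moreover have "U \<subseteq> T" using sub XB by (auto simp: U_def)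
    moreover have "U \<noteq> {}" using nonempty[OF XB[of 0]] n2 by (auto simp: U_def)
    ultimately show False using conn[of U] inU sub_U by blast
  qed
  have all: "X ` {..<n} = \<B>"
  proof
    show "X ` {..<n} \<subseteq> \<B>" using XB by auto
    show "\<B> \<subseteq> X ` {..<n}" using inU sub nonempty UT set_xs by blast
  qed
  show ?thesis
  \<comment> \<open>For \<open>n = 2\<close> the two ends always meet in \<open>p 0\<close>, so
    meeting ends close a cycle only from three blocks on.\<close>
  proof (cases "n \<ge> 3 \<and> K (X 0) \<inter> K (X (n - 1)) \<noteq> {}")
    case False
    then show ?thesis using path[OF n2 all inj injp p inner] UT[symmetric] unfolding U_def by blast
  next
    case True
    then obtain q where n3: "n \<ge> 3" and q: "q \<in> K (X 0)" "q \<in> K (X (n - 1))" by blast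
    have q_neq: "q \<noteq> p j" if "Suc j < n" for j
      using tri'[of 0 j "Suc j" q] tri'[of "n - 1" j "Suc j" q] p[of j] q that n3 by auto
    \<comment> \<open>The chain fixes \<open>p\<close> only below \<open>n - 1\<close>; the element
      \<open>q\<close> common to both ends is the missing joint.\<close>
    define c where "c = p(n - 1 := q)"
    have first: "K (X 0) = {q, p 0}"
    proof (rule mid[of "X (n - 1)" _ "X 1"])
      show "X (n - 1) \<noteq> X 0" "X 1 \<noteq> X 0" using X_eq n3 by auto
    qed (use XB p[of 0] q q_neq[of 0] n3 in auto)
    have last: "K (X (n - 1)) = {p (n - 2), q}"
    proof (rule mid[of "X (n - 2)" _ "X 0"])
      show "X (n - 2) \<noteq> X (n - 1)" "X 0 \<noteq> X (n - 1)" using X_eq n3 by auto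
      show "p (n - 2) \<in> K (X (n - 2))" "p (n - 2) \<in> K (X (n - 1))"
        using p[of "n - 2"] n3 by (auto simp: numeral_2_eq_2 Suc_diff_Suc)
      show "p (n - 2) \<noteq> q" using q_neq[of "n - 2"] n3 by fastforce
    qed (use XB q n3 in auto)
    have suc: "Suc i mod n = (if i = n - 1 then 0 else Suc i)" if "i < n" for i
      using that n3 by (auto simp: mod_Suc)
    have injc: "inj_on c {..<n}"
    proof (rule inj_onI)
      fix i j assume ij: "i \<in> {..<n}" "j \<in> {..<n}" "c i = c j"
      have lt: "Suc l < n" if "l \<in> {..<n}" "l \<noteq> n - 1" for l using that by auto
      show "i = j"
        using q_neq[of i, OF lt] q_neq[of j, OF lt] inj_onD[OF injp, of i j] ij
        by (cases "i = n - 1"; cases "j = n - 1") (auto simp: c_def)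
    qed
    have mem: "c i \<in> K (X i) \<inter> K (X (Suc i mod n))" if "i < n" for i
      using p[of i] q that by (auto simp: suc c_def)
    have blk: "K (X (Suc i mod n)) = {c i, c (Suc i mod n)}" if "i < n" for i
    proof (cases "i = n - 1")
      case True
      then show ?thesis using first that n3 by (simp add: suc c_def)
    next
      case False
      then have sn: "Suc i < n" using that by simp
      show ?thesis
      proof (cases "Suc i = n - 1")
        case True
        then have "i = n - 2" by simp
        then show ?thesis using last True n3 sn by (simp add: suc c_def)
      next
        case False
        then have "Suc (Suc i) < n" "i \<noteq> n - 1" using sn by auto
        then show ?thesis using inner[of i] False sn by (simp add: suc c_def)
      qed
    qed
    have "K (X i) \<subseteq> c ` {..<n}" if "i < n" for i
    proof -
      have "\<exists>j<n. i = Suc j mod n"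
      proof (cases i)
        case 0
        then show ?thesis using n3 by (intro exI[of _ "n - 1"]) auto
      next
        case (Suc j)
        then show ?thesis using that by (intro exI[of _ j]) auto
      qed
      then obtain j where "j < n" "i = Suc j mod n" by blast
      then show ?thesis using blk[of j] n3 by auto
    qed
    then have "T \<subseteq> c ` {..<n}" using UT by (auto simp: U_def)
    moreover have "c ` {..<n} \<subseteq> T" using mem UT by (auto simp: U_def)
    ultimately show ?thesis using cycle[OF n3 all inj injc mem blk] by blast
  qed
qed

section \<open>The lifting graph\<close>

lemma verts_simple_graph [simp]: "verts (simple_graph V R) = V"
  by (simp add: simple_graph_def)

lemma adjacent_simple_graph:
  "adjacent (simple_graph V R) u v \<longleftrightarrow> u \<in> V \<and> v \<in> V \<and> u \<noteq> v \<and> (R u v \<or> R v u)"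
  unfolding adjacent_def simple_graph_def by (auto simp: doubleton_eq_iff)

lemma finite_loopless_simple_graph:
  assumes "finite V"
  shows "finite_loopless_multigraph (simple_graph V R)"
proof -
  have "{{u, v} | u v. u \<in> V \<and> v \<in> V \<and> u \<noteq> v \<and> R u v} \<subseteq> Pow V" by auto
  then have "finite {{u, v} | u v. u \<in> V \<and> v \<in> V \<and> u \<noteq> v \<and> R u v}"
    using assms by (meson finite_Pow_iff finite_subset)
  then show ?thesis using assms by (auto simp: finite_loopless_multigraph_def simple_graph_def)
qed

lemma path_between_refl: "u \<in> verts G \<Longrightarrow> path_between G u u []"
  unfolding path_between_def is_path_def by (rule exI[of _ "[u]"]) simp

lemma edge_disjoint_paths_1: "edge_disjoint_paths G 1 u v \<longleftrightarrow> (\<exists>es. path_between G u v es)"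
proof
  assume "\<exists>es. path_between G u v es"
  then obtain es where "path_between G u v es" by blast
  then show "edge_disjoint_paths G 1 u v"
    unfolding edge_disjoint_paths_def by (intro exI[of _ "\<lambda>_. es"]) (simp add: disjoint_family_on_def)
qed (auto simp: edge_disjoint_paths_def)

text \<open>Menger's theorem for a single path. For \<open>L\<close> it turns disconnectedness into
  a partition without edges across; for the complement it supplies the crossing property that
  \<open>chain_structure\<close> needs.\<close>

lemma connected_simple_graph_iff:
  assumes "finite V"
  shows "connected_graph (simple_graph V R) \<longleftrightarrow>
    (\<forall>U\<subseteq>V. U \<noteq> {} \<longrightarrow> U \<noteq> V \<longrightarrow> (\<exists>u\<in>U. \<exists>v\<in>V - U. adjacent (simple_graph V R) u v))"
    (is "connected_graph ?S \<longleftrightarrow> ?cuts")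
proof -
  note S = finite_loopless_simple_graph[OF assms, of R]
  have cut: "1 \<le> card (edge_cut ?S U) \<longleftrightarrow> (\<exists>u\<in>U. \<exists>v\<in>V - U. adjacent ?S u v)" for U
  proof -
    have "finite (edge_cut ?S U)"
      using S by (simp add: edge_cut_def finite_loopless_multigraph_def)
    then have "1 \<le> card (edge_cut ?S U) \<longleftrightarrow> edge_cut ?S U \<noteq> {}"
      by (simp add: Suc_le_eq card_gt_0_iff)
    also have "\<dots> \<longleftrightarrow> (\<exists>u\<in>U. \<exists>v\<in>V - U. adjacent ?S u v)"
      unfolding edge_cut_eq_between[OF S] between_def adjacent_def by auto
    finally show ?thesis .
  qed
  show ?thesis
  proof
    assume conn: "connected_graph ?S"
    show ?cuts
    proof (intro allI impI)
      fix U assume U: "U \<subseteq> V" "U \<noteq> {}" "U \<noteq> V"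
      then obtain u v where uv: "u \<in> U" "v \<in> V" "v \<notin> U" by blast
      then have "edge_disjoint_paths ?S 1 u v"
        using conn U(1) unfolding edge_disjoint_paths_1 connected_graph_def by auto
      then have "1 \<le> card (edge_cut ?S U)"
        using edge_disjoint_paths_cut[of ?S 1 u v U] uv S
        by (simp add: finite_loopless_multigraph_def)
      then show "\<exists>u\<in>U. \<exists>v\<in>V - U. adjacent ?S u v" unfolding cut .
    qed
  next
    assume cuts: ?cuts
    have "\<exists>es. path_between ?S u v es" if uv: "u \<in> V" "v \<in> V" for u v
    proof (cases "u = v")
      case True
      then show ?thesis using path_between_refl[of u ?S] uv by auto
    next
      case False
      have "1 \<le> card (edge_cut ?S U)" if "U \<subseteq> V" "u \<in> U" "v \<notin> U" for U
        using cuts that uv(2) unfolding cut by blast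
      then have "edge_disjoint_paths ?S 1 u v"
        using Menger_edge[OF S, of u v 1] uv False by simp
      then show ?thesis unfolding edge_disjoint_paths_1 .
    qed
    then show "connected_graph ?S" unfolding connected_graph_def by simp
  qed
qed

section \<open>Liftable pairs in terms of blocks\<close>

context lifting
begin

lemma star_cut:
  assumes "e \<in> incident_edges G s" "X \<subseteq> W"
  shows "e \<in> edge_cut G X \<longleftrightarrow> e \<in> star X"
proof -
  note e = incident_ends[OF assms(1)]
  have "s \<notin> X" "s \<noteq> other_end G s e" using assms(2) e(2) by (auto simp: W_def)
  then show ?thesis using edge_cut_iff[OF e(1), of X] e(3) assms(1) by (auto simp: star_def)
qed

text \<open>For \<open>X\<close> avoiding \<open>s\<close>, the new edge crosses \<open>X\<close>
  exactly when one of the two lifted edges did and the other did not. So the cut changes only if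
  both crossed, and then it loses two edges.\<close>

lemma lift_edges_properties:
  assumes e: "e \<in> incident_edges G s" and f: "f \<in> incident_edges G s" and ef: "e \<noteq> f"
  shows "finite_loopless_multigraph (lift_edges G s e f)" (is "finite_loopless_multigraph ?H")
    and "verts (lift_edges G s e f) = verts G"
    and "X \<subseteq> W \<Longrightarrow> card (edge_cut (lift_edges G s e f) X) + 2 * of_bool (e \<in> star X \<and> f \<in> star X) = d X"
proof -
  define v where "v = other_end G s e"
  define w where "w = other_end G s f"
  have fin: "finite (verts G)" "finite (edges G)" "finite (edge_cut G X)" for X
    using G by (auto simp: finite_loopless_multigraph_def edge_cut_def)
  have ends: "ends G g \<subseteq> verts G" "card (ends G g) = 2" if "g \<in> edges G" for g
    using that G by (auto simp: finite_loopless_multigraph_def)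
  have vw: "v \<in> verts G" "w \<in> verts G" "e \<in> edges G" "f \<in> edges G"
    using incident_ends(2,3)[OF e] incident_ends(2,3)[OF f] by (auto simp: v_def w_def W_def)
  have st: "e \<in> star X \<longleftrightarrow> v \<in> X" "f \<in> star X \<longleftrightarrow> w \<in> X" for X
    using e f by (auto simp: star_def v_def w_def)
  have H: "?H = (if v = w then G\<lparr>edges := edges G - {e, f}\<rparr>
      else G\<lparr>edges := edges G - {f}, ends := (ends G)(e := {v, w})\<rparr>)"
    by (simp add: lift_edges_def v_def w_def Let_def)
  show "finite_loopless_multigraph ?H"
    unfolding H finite_loopless_multigraph_def using fin ends vw by auto
  show "verts ?H = verts G" by (simp add: H)
  assume X: "X \<subseteq> W"
  have cut: "e \<in> edge_cut G X \<longleftrightarrow> v \<in> X" "f \<in> edge_cut G X \<longleftrightarrow> w \<in> X"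
    using star_cut[OF e X] star_cut[OF f X] st by auto
  have two: "card (edge_cut G X - {e, f}) + 2 = d X" if "v \<in> X" "w \<in> X"
  proof -
    have "{e, f} \<subseteq> edge_cut G X" using cut that by simp
    then have "card (edge_cut G X - {e, f}) = d X - card {e, f}" "card {e, f} \<le> d X"
      using fin(3) unfolding d_def by (simp_all add: card_Diff_subset card_mono)
    then show ?thesis using ef by simp
  qed
  show "card (edge_cut ?H X) + 2 * of_bool (e \<in> star X \<and> f \<in> star X) = d X"
  proof (cases "v = w")
    case True
    then have "edge_cut ?H X = edge_cut G X - {e, f}" by (auto simp: H edge_cut_def)
    then show ?thesis using True two cut unfolding st by (cases "v \<in> X") (auto simp: d_def)
  next
    case False
    have same: "g \<in> edge_cut ?H X \<longleftrightarrow> g \<in> edge_cut G X" if "g \<noteq> e" "g \<noteq> f" for g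
      using False that by (simp add: H edge_cut_def)
    have fH: "f \<notin> edge_cut ?H X" using False by (simp add: H edge_cut_def)
    have "ends ?H e = {v, w}" "e \<in> edges ?H" using False ef vw by (auto simp: H)
    then have eH: "e \<in> edge_cut ?H X \<longleftrightarrow> (v \<in> X) \<noteq> (w \<in> X)" using edge_cut_iff False by metis
    have char: "g \<in> edge_cut ?H X \<longleftrightarrow>
        (if g = e then (v \<in> X) \<noteq> (w \<in> X) else g \<noteq> f \<and> g \<in> edge_cut G X)" for g
      using same[of g] fH eH by auto
    consider "v \<in> X" "w \<in> X" | "v \<in> X" "w \<notin> X" | "v \<notin> X" "w \<in> X" | "v \<notin> X" "w \<notin> X" by blast
    then show ?thesis
    proof cases
      case 1
      have "edge_cut ?H X = edge_cut G X - {e, f}"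
        using 1 by (intro set_eqI) (auto simp: char)
      then show ?thesis using two 1 unfolding st by simp
    next
      case 2
      have "edge_cut ?H X = edge_cut G X" using 2 cut by (intro set_eqI) (auto simp: char)
      then show ?thesis using 2 unfolding st by (simp add: d_def)
    next
      case 3
      \<comment> \<open>The new edge inherits the name \<open>e\<close>, so here \<open>e\<close>
        enters the cut in place of \<open>f\<close>.\<close>
      have "edge_cut ?H X = insert e (edge_cut G X - {f})"
        using 3 cut ef by (intro set_eqI) (auto simp: char)
      then have "card (edge_cut ?H X) = Suc (card (edge_cut G X - {f}))"
        using fin(3) cut 3 by simp
      also have "\<dots> = d X" unfolding d_def using cut 3 fin(3) by (intro card_Suc_Diff1) auto
      finally show ?thesis using 3 unfolding st by simp
    next
      case 4
      have "edge_cut ?H X = edge_cut G X" using 4 cut by (intro set_eqI) (auto simp: char)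
      then show ?thesis using 4 unfolding st by (simp add: d_def)
    qed
  qed
qed

definition joint :: "'e \<Rightarrow> 'e \<Rightarrow> bool" where
  "joint e f \<longleftrightarrow> (\<exists>X. block X \<and> e \<in> star X \<and> f \<in> star X)"

lemma joint_commute: "joint e f \<longleftrightarrow> joint f e"
  by (auto simp: joint_def)

lemma liftable_pair_iff:
  assumes e: "e \<in> incident_edges G s" and f: "f \<in> incident_edges G s" and ef: "e \<noteq> f"
  shows "liftable_pair G s k e f \<longleftrightarrow> \<not> joint e f"
proof -
  note H = lift_edges_properties[OF e f ef]
  have "liftable_pair G s k e f \<longleftrightarrow>
    (\<forall>X\<subseteq>W. X \<noteq> {} \<longrightarrow> X \<noteq> W \<longrightarrow> k \<le> card (edge_cut (lift_edges G s e f) X))"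
    unfolding liftable_pair_def sk_edge_connected_iff_cuts[OF H(1)] H(2) W_def
    using e f ef sk by (auto simp: sk_edge_connected_def)
  also have "\<dots> \<longleftrightarrow> (\<forall>X. dangerous X \<longrightarrow> \<not> (e \<in> star X \<and> f \<in> star X))"
  proof -
    have "k \<le> card (edge_cut (lift_edges G s e f) X) \<longleftrightarrow>
        (d X \<le> k + 1 \<longrightarrow> \<not> (e \<in> star X \<and> f \<in> star X))"
      if "X \<subseteq> W" "X \<noteq> {}" "X \<noteq> W" for X
      using H(3)[OF that(1)] cuts[OF that] by (cases "e \<in> star X \<and> f \<in> star X") auto
    then show ?thesis unfolding dangerous_def by metis
  qed
  also have "\<dots> \<longleftrightarrow> \<not> joint e f"
  proof -
    have "joint e f" if D: "dangerous X" "e \<in> star X" "f \<in> star X" for X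
    proof -
      have "{e, f} \<subseteq> star X" using D by simp
      then have "card {e, f} \<le> card (star X)" by (intro card_mono) auto
      then have "card (star X) \<ge> 2" using ef by simp
      then obtain Y where "block Y" "X \<subseteq> Y" by (rule dangerous_imp_block[OF D(1)])
      then show ?thesis using star_mono D(2,3) unfolding joint_def by blast
    qed
    then show ?thesis unfolding joint_def block_def by blast
  qed
  finally show ?thesis .
qed

abbreviation T :: "'e set" where "T \<equiv> incident_edges G s"

abbreviation L :: "'e sgraph" where "L \<equiv> lifting_graph G s k"

abbreviation C :: "'e sgraph" where "C \<equiv> complement_graph L"

lemma verts_L [simp]: "verts L = T" and verts_C [simp]: "verts C = T"
  by (simp_all add: lifting_graph_def complement_graph_def)

lemma adjacent_L: "adjacent L e f \<longleftrightarrow> e \<in> T \<and> f \<in> T \<and> e \<noteq> f \<and> \<not> joint e f"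
  unfolding lifting_graph_def adjacent_simple_graph
  using liftable_pair_iff joint_commute by metis

lemma adjacent_C: "adjacent C e f \<longleftrightarrow> e \<in> T \<and> f \<in> T \<and> e \<noteq> f \<and> joint e f"
  unfolding complement_graph_def adjacent_simple_graph adjacent_L verts_L
  using joint_commute by metis

lemma connected_L_iff: "connected_graph L \<longleftrightarrow>
    (\<forall>U\<subseteq>T. U \<noteq> {} \<longrightarrow> U \<noteq> T \<longrightarrow> (\<exists>u\<in>U. \<exists>v\<in>T - U. adjacent L u v))"
  unfolding lifting_graph_def by (rule connected_simple_graph_iff[OF finite_incident])

lemma connected_C_iff: "connected_graph C \<longleftrightarrow>
    (\<forall>U\<subseteq>T. U \<noteq> {} \<longrightarrow> U \<noteq> T \<longrightarrow> (\<exists>u\<in>U. \<exists>v\<in>T - U. adjacent C u v))"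
  unfolding complement_graph_def verts_L by (rule connected_simple_graph_iff[OF finite_incident])

lemma card_T: "card T = degree G s" by (simp add: degree_def)

lemma T_not_singleton: "{e} \<noteq> T"
proof
  assume "{e} = T"
  then have "card {e} = degree G s" using card_T by simp
  then show False using deg by simp
qed

section \<open>Size bounds and disconnected lifting graphs\<close>

lemma block_star_bound: "block X \<Longrightarrow> 2 * card (star X) \<le> degree G s + 1"
  using star_bound[OF blockD(1-3)] blockD(4)[of X] by fastforce

lemma share_star_bound:
  assumes "block X" "block Y" "X \<noteq> Y" "p \<in> star X" "p \<in> star Y" "X \<union> Y \<noteq> W"
  shows "2 * card (star X \<union> star Y) \<le> degree G s + 2"
  using star_bound[of "X \<union> Y"] share_proper(3)[OF assms] blockD(1,2)[OF assms(1)]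
    blockD(1)[OF assms(2)] assms(6) by (auto simp: star_Un)

text \<open>Edges joint with \<open>p\<close> lie in blocks through \<open>p\<close>, and by
  \<open>no_triple\<close> there are at most two; the size bound applies because they are not a
  special pair. A single block is reported as \<open>X = Y\<close>.\<close>

lemma joint_bound:
  assumes nosp: "\<And>X Y. \<not> special_pair X Y" and S: "S \<noteq> {}" "\<And>q. q \<in> S \<Longrightarrow> joint p q"
  obtains X Y where "block X" "block Y" "p \<in> star X" "p \<in> star Y" "insert p S \<subseteq> star X \<union> star Y"
    "2 * card (star X \<union> star Y) \<le> degree G s + 2"
proof -
  obtain q where "q \<in> S" using S(1) by blast
  then obtain X where X: "block X" "p \<in> star X" "q \<in> star X" using S(2) by (auto simp: joint_def)
  show ?thesis
  proof (cases "S \<subseteq> star X")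
    case True
    then show ?thesis using that[of X X] X block_star_bound[OF X(1)] by auto
  next
    case False
    then obtain q' where q': "q' \<in> S" "q' \<notin> star X" by blast
    then obtain Y where Y: "block Y" "p \<in> star Y" "q' \<in> star Y" using S(2) by (auto simp: joint_def)
    have XY: "X \<noteq> Y" using Y q' by blast
    have "S \<subseteq> star X \<union> star Y"
    proof
      fix t assume "t \<in> S"
      then obtain Z where Z: "block Z" "p \<in> star Z" "t \<in> star Z" using S(2) by (auto simp: joint_def)
      then show "t \<in> star X \<union> star Y" using no_triple[OF X(1) Y(1) Z(1) X(2) Y(2) Z(2)] XY by blast
    qed
    moreover have "X \<union> Y \<noteq> W" using nosp[of X Y] X Y XY by (auto simp: special_pair_def)
    ultimately show ?thesis
      using that[OF X(1) Y(1) X(2) Y(2)] share_star_bound[OF X(1) Y(1) XY X(2) Y(2)] X(2) by simp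
  qed
qed

text \<open>If \<open>P\<close> and \<open>Q\<close> are separated in \<open>L\<close>, the at most two blocks through an edge of \<open>P\<close> cover
  \<open>Q\<close> and vice versa. The size bound then makes both covers exact, so that a block meeting \<open>P\<close> and
  \<open>Q\<close> has only one edge in each of them; but one of the two blocks covering \<open>Q\<close> has more.\<close>

lemma disconnected_special:
  assumes "\<not> connected_graph L"
  shows "\<exists>X Y. special_pair X Y"
proof (rule ccontr)
  assume "\<not> ?thesis"
  then have nosp: "\<And>X Y. \<not> special_pair X Y" by blast
  obtain P where P: "P \<subseteq> T" "P \<noteq> {}" "P \<noteq> T" "\<And>u v. u \<in> P \<Longrightarrow> v \<in> T - P \<Longrightarrow> \<not> adjacent L u v"
    using assms unfolding connected_L_iff by blast
  define Q where "Q = T - P"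
  have Qne: "Q \<noteq> {}" using P by (auto simp: Q_def)
  have fin: "finite P" "finite Q" using P(1) finite_incident finite_subset by (auto simp: Q_def)
  have cards: "card P + card Q = degree G s"
    using card_Diff_subset[OF fin(1) P(1)] card_mono[OF finite_incident P(1)]
    by (simp add: Q_def card_T)
  have joint: "joint u v" if "u \<in> P" "v \<in> Q" for u v
    using P(1) P(4)[of u v] that adjacent_L[of u v] by (auto simp: Q_def)
  have disj: "P \<inter> Q = {}" by (auto simp: Q_def)
  have cP: "card (insert u Q) = card Q + 1" if "u \<in> P" for u
  proof -
    have "u \<notin> Q" using that disj by blast
    then show ?thesis using fin by simp
  qed
  have cQ: "card (insert v P) = card P + 1" if "v \<in> Q" for v
  proof -
    have "v \<notin> P" using that disj by blast
    then show ?thesis using fin by simp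
  qed
  obtain u0 v0 where uv: "u0 \<in> P" "v0 \<in> Q" using P(2) Qne by blast
  obtain X Y where XY: "block X" "block Y" "u0 \<in> star X" "u0 \<in> star Y"
    "insert u0 Q \<subseteq> star X \<union> star Y" "2 * card (star X \<union> star Y) \<le> degree G s + 2"
    using joint_bound[OF nosp Qne, of u0] joint uv(1) by blast
  have leQ: "card Q + 1 \<le> card (star X \<union> star Y)"
    using card_mono[OF _ XY(5)] cP[OF uv(1)] by simp
  have cover: "\<exists>X Y. block X \<and> block Y \<and> v \<in> star X \<and> v \<in> star Y \<and>
     insert v P \<subseteq> star X \<union> star Y \<and> 2 * card (star X \<union> star Y) \<le> degree G s + 2" if "v \<in> Q" for v
    using joint_bound[OF nosp P(2), of v] joint joint_commute that by metis
  then obtain X' Y' where X'Y': "insert v0 P \<subseteq> star X' \<union> star Y'"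
    "2 * card (star X' \<union> star Y') \<le> degree G s + 2" using uv(2) by blast
  have leP: "card P + 1 \<le> card (star X' \<union> star Y')"
    using card_mono[OF _ X'Y'(1)] cQ[OF uv(2)] by simp
  have half: "2 * card P = degree G s" "2 * card Q = degree G s"
    using leP leQ XY(6) X'Y'(2) cards by linarith+
  have eqQ: "insert u0 Q = star X \<union> star Y"
    using card_seteq[OF _ XY(5)] cP[OF uv(1)] XY(6) half by simp
  have "card (star X \<union> star Y) + card (star X \<inter> star Y) = card (star X) + card (star Y)"
    using card_Un_Int[OF finite_star finite_star] by metis
  moreover have "card (star X \<inter> star Y) \<ge> 1"
    using XY(3,4) by (simp add: Suc_le_eq card_gt_0_iff) blast
  \<comment> \<open>Now \<open>card Q = deg(s) / 2\<close> is at least 3, so the two stars cover at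
    least four edges and share \<open>u0\<close>; one of them has at least three.\<close>
  ultimately have "card (star X) \<ge> 3 \<or> card (star Y) \<ge> 3" using leQ half deg by linarith
  then obtain Z where Z: "block Z" "u0 \<in> star Z" "card (star Z) \<ge> 3" "star Z \<subseteq> insert u0 Q"
    using XY(1-4) eqQ by (metis Un_upper1 Un_upper2)
  have "\<not> card (star Z - {u0}) \<le> Suc 0" using Z by (simp add: card_Diff_singleton)
  then obtain a b where ab: "a \<in> star Z - {u0}" "b \<in> star Z - {u0}" "a \<noteq> b"
    using card_le_Suc0_iff_eq[of "star Z - {u0}"] by auto
  have aQ: "a \<in> Q" "b \<in> Q" using ab Z(4) by auto
  obtain X2 Y2 where X2: "block X2" "block Y2" "a \<in> star X2" "a \<in> star Y2"
    "insert a P \<subseteq> star X2 \<union> star Y2" "2 * card (star X2 \<union> star Y2) \<le> degree G s + 2"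
    using cover[OF aQ(1)] by blast
  have "insert a P = star X2 \<union> star Y2"
    using card_seteq[OF _ X2(5)] cQ[OF aQ(1)] X2(6) half by simp
  \<comment> \<open>The edge \<open>a\<close> lies in both \<open>X2\<close> and \<open>Y2\<close>,
    and \<open>u0\<close> in one of them; that block shares two edges with \<open>Z\<close>.\<close>
  moreover have "Z = X2 \<or> Z = Y2"
    using block_eqI[OF Z(1) X2(1), of a u0] block_eqI[OF Z(1) X2(2), of a u0] ab(1) Z(2) X2(3-5) uv(1)
    by blast
  ultimately have "b \<in> insert a P" using ab(2) by blast
  then show False using ab(3) aQ(2) disj by blast
qed

lemma special_joint:
  assumes "special_pair X Y"
  shows "joint u v \<longleftrightarrow> u \<in> star X \<and> v \<in> star X \<or> u \<in> star Y \<and> v \<in> star Y"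
  using special_blocks[OF assms] assms unfolding joint_def special_pair_def by blast

lemma special_share:
  assumes "special_pair X Y"
  obtains p where "star X \<inter> star Y = {p}"
  using assms share(5) unfolding special_pair_def by blast

text \<open>The complement of \<open>L\<close> consists of two equally large cliques sharing
  \<open>p\<close>, so \<open>p\<close> is isolated in \<open>L\<close> and the remaining edges are
  adjacent exactly across.\<close>

lemma special_isolated:
  assumes sp: "special_pair X Y"
  shows "isolated_plus_balanced_complete_bipartite L" "odd (degree G s)"
proof -
  note c = special_card[OF sp]
  show "odd (degree G s)" using c(1) by presburger
  obtain p where p: "star X \<inter> star Y = {p}" by (rule special_share[OF sp])
  let ?A = "star X - {p}" and ?B = "star Y - {p}"
  have "p \<in> star X" "p \<in> star Y" using p by blast+
  then have "card ?A = card ?B" using c(1,2) by (simp add: card_Diff_singleton)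
  moreover have "verts L = {p} \<union> ?A \<union> ?B" using p c(3) by auto
  moreover have "?A \<inter> ?B = {}" using p by blast
  moreover have "adjacent L u v \<longleftrightarrow> (u \<in> ?A \<and> v \<in> ?B) \<or> (u \<in> ?B \<and> v \<in> ?A)"
    if "u \<in> T" "v \<in> T" for u v
    using that p c(3) unfolding adjacent_L special_joint[OF sp] by blast
  ultimately show "isolated_plus_balanced_complete_bipartite L"
    unfolding isolated_plus_balanced_complete_bipartite_def
    by (intro exI[of _ p] exI[of _ ?A] exI[of _ ?B]) simp
qed

text \<open>An isolated vertex disconnects \<open>L\<close>. Hence the case distinction of the
  theorem, made in terms of \<open>L\<close>, coincides with the existence of a special
  pair.\<close>

lemma isolated_imp_special:
  assumes "isolated_plus_balanced_complete_bipartite L"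
  shows "\<exists>X Y. special_pair X Y"
proof (rule disconnected_special)
  obtain x A B where x: "T = {x} \<union> A \<union> B" "x \<notin> A" "x \<notin> B"
    "\<And>u v. u \<in> T \<Longrightarrow> v \<in> T \<Longrightarrow> adjacent L u v \<longleftrightarrow> (u \<in> A \<and> v \<in> B) \<or> (u \<in> B \<and> v \<in> A)"
    using assms unfolding isolated_plus_balanced_complete_bipartite_def verts_L by blast
  have "{x} \<noteq> T" by (rule T_not_singleton)
  moreover have "\<not> adjacent L x v" if "v \<in> T" for v using x that by blast
  ultimately show "\<not> connected_graph L" unfolding connected_L_iff using x(1) by blast
qed

text \<open>Overlapping blocks that do not cover \<open>V - s\<close> force \<open>k\<close> to be
  odd, so for even \<open>k\<close> the stars of blocks are disjoint and can serve as the
  parts.\<close>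

lemma even_multipartite:
  assumes "even k" and nosp: "\<And>X Y. \<not> special_pair X Y"
  shows "complete_multipartite L"
proof -
  have disj: "star X \<inter> star Y = {}" if "block X" "block Y" "X \<noteq> Y" for X Y
  proof (rule ccontr)
    assume ne: "star X \<inter> star Y \<noteq> {}"
    then have "X \<union> Y \<noteq> W" using nosp[of X Y] that by (simp add: special_pair_def)
    then show False using ne share_proper(1)[OF that] assms(1) by blast
  qed
  \<comment> \<open>Edges in no block are liftable with every other edge and become singleton
    parts.\<close>
  define P where "P = {star X | X. block X} \<union> {{e} | e. e \<in> T \<and> (\<forall>X. block X \<longrightarrow> e \<notin> star X)}"
  have cls: "(\<exists>X. block X \<and> A = star X) \<or> (\<exists>e. A = {e} \<and> (\<forall>X. block X \<longrightarrow> e \<notin> star X))"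
    if "A \<in> P" for A
    using that unfolding P_def by blast
  have star_ne: "star X \<noteq> {}" if "block X" for X using blockD(5)[OF that] by auto
  have UP: "\<Union>P = T"
  proof
    show "\<Union>P \<subseteq> T" using star_subset unfolding P_def by blast
    show "T \<subseteq> \<Union>P" unfolding P_def by blast
  qed
  have part: "partition_on T P"
  proof (rule partition_onI)
    show "{} \<notin> P" using cls[of "{}"] star_ne by blast
  next
    fix A B assume AB: "A \<in> P" "B \<in> P" "A \<noteq> B"
    show "disjnt A B"
    proof (cases "(\<exists>X. block X \<and> A = star X) \<and> (\<exists>Y. block Y \<and> B = star Y)")
      case True
      then obtain X Y where "block X" "block Y" "A = star X" "B = star Y" by blast
      then show ?thesis using disj[of X Y] AB(3) by (cases "X = Y") (auto simp: disjnt_def)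
    next
      case False
      then show ?thesis using cls[OF AB(1)] cls[OF AB(2)] AB(3) unfolding disjnt_def by blast
    qed
  qed (rule UP)
  have "star X \<noteq> T" if "block X" for X
  proof
    assume "star X = T"
    then show False using block_star_bound[OF that] deg card_T by simp
  qed
  then have TP: "T \<notin> P" using cls[of T] T_not_singleton by metis
  have "finite P" using finite_elements[OF finite_incident part] .
  moreover have "P \<noteq> {}"
  proof
    assume "P = {}"
    then have "T = {}" using UP by simp
    then show False using deg card_T by simp
  qed
  moreover have "card P \<noteq> 1"
  proof
    assume "card P = 1"
    then obtain A where "P = {A}" by (auto simp: card_1_singleton_iff)
    then show False using UP TP by simp
  qed
  ultimately have "card P \<ge> 2" by (metis One_nat_def Suc_1 Suc_leI card_gt_0_iff le_neq_implies_less)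
  moreover have "adjacent L u v \<longleftrightarrow> \<not> (\<exists>X\<in>P. u \<in> X \<and> v \<in> X)" if "u \<in> T" "v \<in> T" for u v
  proof (cases "u = v")
    case True
    then show ?thesis using that UP adjacent_L by blast
  next
    case False
    then have "(\<exists>X\<in>P. u \<in> X \<and> v \<in> X) \<longleftrightarrow> joint u v" unfolding P_def joint_def by blast
    then show ?thesis using that False adjacent_L by blast
  qed
  ultimately show ?thesis using part unfolding complete_multipartite_def verts_L by blast
qed

end

section \<open>Blobs\<close>

context lifting
begin

lemma blob_conditionI:
  assumes X: "X \<subseteq> W" and Y: "Y \<subseteq> W" "X \<inter> Y = {}" and Z: "Z \<subseteq> W" "X \<inter> Z = {}"
    and "d X = 2 * r + 1" "card (star X) = 1" "m X Y = r" "m X Z = r"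
  shows "blob_condition G s r Y X Z"
proof -
  \<comment> \<open>For a set disjoint from \<open>X\<close>, cut edges with an end in it are the
    edges between the two sets; this turns the counts of \<open>blob_condition\<close> into values
    of \<open>m\<close>.\<close>
  have to: "{e \<in> edge_cut G X. ends G e \<inter> A \<noteq> {}} = between G X A" if A: "A \<subseteq> verts G" "X \<inter> A = {}" for A
  proof (rule set_eqI)
    fix e
    show "e \<in> {e \<in> edge_cut G X. ends G e \<inter> A \<noteq> {}} \<longleftrightarrow> e \<in> between G X A"
    proof (cases "e \<in> edges G")
      case True
      obtain x y where xy: "ends G e = {x, y}" "x \<noteq> y" by (rule edge_ends[OF G True])
      have "e \<in> between G X A \<longleftrightarrow> (x \<in> X \<and> y \<in> A \<or> y \<in> X \<and> x \<in> A)"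
        using True unfolding between_def mem_Collect_eq xy(1) doubleton_eq_iff by blast
      moreover have "ends G e \<inter> A \<noteq> {} \<longleftrightarrow> x \<in> A \<or> y \<in> A" using xy(1) by auto
      ultimately show ?thesis
        using edge_cut_iff[OF xy, of X] True A(2) by blast
    qed (simp add: edge_cut_def between_def)
  qed
  have "{e \<in> edge_cut G X. s \<in> ends G e} = {e \<in> edge_cut G X. ends G e \<inter> {s} \<noteq> {}}" by auto
  also have "\<dots> = star X"
    using to[of "{s}"] s_in W_sub(2)[OF X] star_eq_between[OF X] by simp
  finally have "card {e \<in> edge_cut G X. s \<in> ends G e} = 1" using assms(7) by simp
  then show ?thesis
    using to[OF W_sub(1)[OF Y(1)] Y(2)] to[OF W_sub(1)[OF Z(1)] Z(2)] assms(6,8,9)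
    by (simp add: blob_condition_def d_def m_def)
qed

text \<open>When \<open>X \<union> Y = W\<close>, maximality gives no bound for the union, so the
  cut of \<open>X \<inter> Y\<close> is only known to be some \<open>2 * r + 1 \<ge> k\<close>, with
  \<open>r\<close> counting its edges to either side. The outer blobs \<open>X - Y\<close> and
  \<open>Y - X\<close> have cut exactly \<open>k\<close>, which makes them edge-connected as
  required.\<close>

lemma special_structure:
  assumes sp: "special_pair X Y"
  shows "two_equal_cliques_joined_by_path C"
    and "\<exists>r H. path_structure G s r 3 H \<and> (real k - 1) / 2 \<le> real r \<and>
      (\<forall>i<3. i \<noteq> 1 \<longrightarrow> edge_connected (nat \<lceil>real k / 2\<rceil>) (induced_subgraph G (H i)))"
proof -
  note c = special_card[OF sp]
  have XY: "block X" "block Y" "X \<noteq> Y" "X \<union> Y = W" using sp by (auto simp: special_pair_def)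
  note X = blockD[OF XY(1)] and Y = blockD[OF XY(2)]
  obtain p where p: "star X \<inter> star Y = {p}" by (rule special_share[OF sp])
  then have pXY: "p \<in> star X" "p \<in> star Y" by blast+
  note sh = share[OF XY(1-3) pXY]
  show "two_equal_cliques_joined_by_path C"
    unfolding two_equal_cliques_joined_by_path_def
  proof (rule exI[of _ "star X"], rule exI[of _ "star Y"], rule exI[of _ "[p]"], intro conjI ballI)
    fix u v assume "u \<in> verts C" "v \<in> verts C"
    then show "adjacent C u v \<longleftrightarrow> u \<noteq> v \<and> (u \<in> star X \<and> v \<in> star X \<or> u \<in> star Y \<and> v \<in> star Y \<or>
      (\<exists>i. Suc i < length [p] \<and> {u, v} = {[p] ! i, [p] ! Suc i}))"
      using adjacent_C special_joint[OF sp] by simp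
  qed (use p pXY c in auto)
  define r where "r = m (X \<inter> Y) (X - Y)"
  define H where "H = (\<lambda>i::nat. if i = 0 then X - Y else if i = 1 then X \<inter> Y else Y - X)"
  note cp = cut_pair[OF W_sub(1)[OF X(1)] W_sub(1)[OF Y(1)]]
  have r: "m (X \<inter> Y) (Y - X) = r" "d (X \<inter> Y) = 2 * r + 1"
    using cp sh unfolding r_def by linarith+
  have starI: "star (X \<inter> Y) = {p}" using p by (simp add: star_Int)
  then have "X \<inter> Y \<noteq> {}" by auto
  then have "k \<le> d (X \<inter> Y)" using X by (intro cuts) blast+
  then have k: "k \<le> 2 * r + 1" using r by simp
  have blob: "blob_condition G s r (X - Y) (X \<inter> Y) (Y - X)"
  proof (rule blob_conditionI)
    show "m (X \<inter> Y) (X - Y) = r" by (simp add: r_def)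
  qed (use X(1) Y(1) r starI in auto)
  have cover: "blob_cover G s 3 H"
    unfolding blob_cover_def
  proof
    have "{..<3} = {0, 1, 2::nat}" by auto
    then show "(\<Union>i<3. H i) = verts G - {s}" using XY(4) unfolding W_def H_def by auto
    show "disjoint_family_on H {..<3}" unfolding disjoint_family_on_def H_def by auto
  qed
  have one: "i = 1" if "1 \<le> i \<and> i \<le> 3 - 2" for i :: nat using that by simp
  have "path_structure G s r 3 H"
    unfolding path_structure_def
  proof (intro conjI allI impI)
    show "1 \<le> r" using k k2 by simp
    fix i :: nat assume "1 \<le> i \<and> i \<le> 3 - 2"
    then have "i = 1" by (rule one)
    then show "blob_condition G s r (H (i - 1)) (H i) (H (i + 1))" using blob by (simp add: H_def)
  qed (use cover in auto)
  moreover have "(real k - 1) / 2 \<le> real r" using of_nat_mono[OF k, where 'a = real] by simp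
  moreover have "edge_connected (nat \<lceil>real k / 2\<rceil>) (induced_subgraph G (H i))" if "i \<noteq> 1" for i
  proof -
    have "edge_connected (nat \<lceil>real k / 2\<rceil>) (induced_subgraph G (X - Y))"
      using block_Diff[OF XY(1-3)] sh(3) by (intro edge_connected_tight)
    moreover have "edge_connected (nat \<lceil>real k / 2\<rceil>) (induced_subgraph G (Y - X))"
      using block_Diff[OF XY(2,1) XY(3)[symmetric]] sh(4) by (intro edge_connected_tight)
    ultimately show ?thesis using that by (simp add: H_def)
  qed
  ultimately show "\<exists>r H. path_structure G s r 3 H \<and> (real k - 1) / 2 \<le> real r \<and>
      (\<forall>i<3. i \<noteq> 1 \<longrightarrow> edge_connected (nat \<lceil>real k / 2\<rceil>) (induced_subgraph G (H i)))" by blast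
qed

text \<open>The only edge from \<open>X \<inter> Y\<close> leaving \<open>X \<union> Y\<close> is
  the one to \<open>s\<close>, so the blob has no edges to other vertices outside the two
  blocks.\<close>

lemma inner_blob:
  assumes "block X" "block Y" "X \<noteq> Y" "p \<in> star X" "p \<in> star Y" "X \<union> Y \<noteq> W"
  shows "blob_condition G s (k div 2) (X - Y) (X \<inter> Y) (Y - X)"
    and "S \<subseteq> W \<Longrightarrow> S \<inter> (X \<union> Y) = {} \<Longrightarrow> m (X \<inter> Y) S = 0"
proof -
  note X = blockD[OF assms(1)] and Y = blockD[OF assms(2)]
  note sh = share[OF assms(1-5)] share_proper[OF assms]
  have st: "star (X \<inter> Y) = {p}" using sh(5) by (simp add: star_Int)
  show "blob_condition G s (k div 2) (X - Y) (X \<inter> Y) (Y - X)"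
  proof (rule blob_conditionI)
    show "d (X \<inter> Y) = 2 * (k div 2) + 1" using sh(7,8) by simp
  qed (use X(1) Y(1) sh st in auto)
  assume S: "S \<subseteq> W" "S \<inter> (X \<union> Y) = {}"
  have IW: "X \<inter> Y \<subseteq> W" using X(1) by blast
  have "m (X \<inter> Y) ({s} \<union> S) \<le> m (X \<inter> Y) (verts G - (X \<union> Y))"
    using S s_in X(1) Y(1) by (intro m_mono) (auto simp: W_def)
  moreover have "m (X \<inter> Y) ({s} \<union> S) = m (X \<inter> Y) {s} + m (X \<inter> Y) S"
    using S(1) X(1) by (intro m_Un_right) (auto simp: W_def)
  moreover have "m (X \<inter> Y) {s} = 1" using card_star[OF IW] st by simp
  ultimately show "m (X \<inter> Y) S = 0" using sh(6) by simp
qed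

section \<open>Cycle and path structures without a special pair\<close>

definition structured :: bool where
  "structured \<longleftrightarrow> (\<exists>n H.
     (is_hamilton_cycle C \<and> cycle_structure G s (k div 2) n H \<or>
      two_equal_cliques_joined_by_path C \<and> path_structure G s (k div 2) n H) \<and>
     (\<forall>i<n. edge_connected (nat \<lceil>real k / 2\<rceil>) (induced_subgraph G (H i))))"

lemma joint_range:
  assumes "X ` {..<n} = {X. block X}"
  shows "joint u v \<longleftrightarrow> (\<exists>i<n. u \<in> star (X i) \<and> v \<in> star (X i))"
proof
  assume "joint u v"
  then obtain Z where "Z \<in> X ` {..<n}" "u \<in> star Z" "v \<in> star Z"
    using assms by (auto simp: joint_def)
  then show "\<exists>i<n. u \<in> star (X i) \<and> v \<in> star (X i)" by blast
next
  assume "\<exists>i<n. u \<in> star (X i) \<and> v \<in> star (X i)"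
  then obtain i where "i < n" "u \<in> star (X i)" "v \<in> star (X i)" by blast
  moreover from this(1) have "block (X i)" using assms by blast
  ultimately show "joint u v" unfolding joint_def by blast
qed

text \<open>Blob \<open>i\<close> is the intersection of the blocks \<open>i\<close> and
  \<open>i + 1\<close>, where \<open>p i\<close> ends. All blobs have cut \<open>k\<close>, hence
  are pairwise disjoint, and by \<open>middle_block\<close> every block is the union of two
  consecutive blobs. The differences in \<open>inner_blob\<close> are therefore the neighbouring
  blobs.\<close>

lemma cycle_case:
  assumes nosp: "\<And>X Y. \<not> special_pair X Y"
    and n: "n \<ge> 3" and XB: "X ` {..<n} = {X. block X}" and injX: "inj_on X {..<n}"
    and injp: "inj_on p {..<n}"
    and p: "\<And>i. i < n \<Longrightarrow> p i \<in> star (X i) \<inter> star (X (Suc i mod n))"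
    and K: "\<And>i. i < n \<Longrightarrow> star (X (Suc i mod n)) = {p i, p (Suc i mod n)}"
    and T: "T = p ` {..<n}"
  shows structured "odd k"
proof -
  define r where "r = k div 2"
  define nx where "nx = (\<lambda>i. Suc i mod n)"
  define pv where "pv = (\<lambda>i. (i + n - 1) mod n)"
  have lt: "nx i < n" "pv i < n" for i using n by (auto simp: nx_def pv_def)
  have nxi: "nx i = (if Suc i = n then 0 else Suc i)" if "i < n" for i
    using that by (auto simp: nx_def)
  have pvi: "pv i = (if i = 0 then n - 1 else i - 1)" if "i < n" for i
    using that n by (cases i) (auto simp: pv_def)
  have nxpv: "nx (pv i) = i" if "i < n" for i
    using that n by (cases i) (auto simp: nx_def pvi)
  have neq: "nx i \<noteq> i" "pv i \<noteq> i" "nx i \<noteq> pv i" if "i < n" for i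
    using that n by (auto simp: nxi pvi)
  have blk: "block (X i)" if "i < n" for i using XB that by blast
  have Xne: "X i \<noteq> X j" if "i < n" "j < n" "i \<noteq> j" for i j using injX that by (auto dest: inj_onD)
  have pne: "p i \<noteq> p j" if "i < n" "j < n" "i \<noteq> j" for i j using injp that by (auto dest: inj_onD)
  define H where "H = (\<lambda>i. X i \<inter> X (nx i))"
  have pX: "p i \<in> star (X i)" "p i \<in> star (X (nx i))" if "i < n" for i
    using p[OF that] by (auto simp: nx_def)
  have UW: "X i \<union> X j \<noteq> W" if "i < n" "j < n" "i \<noteq> j" "q \<in> star (X i)" "q \<in> star (X j)" for i j q
    using nosp[of "X i" "X j"] blk Xne[OF that(1-3)] that unfolding special_pair_def by blast
  have pairs: "block (X i)" "block (X (nx i))" "X i \<noteq> X (nx i)" "p i \<in> star (X i)"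
      "p i \<in> star (X (nx i))" "X i \<union> X (nx i) \<noteq> W" if "i < n" for i
    using blk that lt Xne[OF that lt(1)] neq(1)[OF that] pX[OF that] UW[OF that lt(1)]
    by auto
  have starH: "star (H i) = {p i}" if "i < n" for i
    using share(5)[OF pairs(1-5)[OF that]] by (simp add: H_def star_Int)
  have odd: "odd k" using share_proper(1)[OF pairs[of 0]] n by simp
  then show "odd k" .
  have dH: "d (H i) = k" if "i < n" for i
    using share_proper(2)[OF pairs[OF that]] by (simp add: H_def)
  have HW: "H i \<subseteq> W" if "i < n" for i using blockD(1)[OF blk[OF that]] by (auto simp: H_def)
  have HneW: "H i \<noteq> W" if "i < n" for i
    using blockD(1,3)[OF blk[OF that]] by (auto simp: H_def)
  have disj: "H i \<inter> H j = {}" if ij: "i < n" "j < n" "i \<noteq> j" for i j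
  proof (rule tight_disjoint)
    show "H i \<subseteq> W" "H j \<subseteq> W" "d (H i) = k" "d (H j) = k" "odd k"
      using HW dH ij odd by auto
    have "star (H i - H j) \<noteq> {}" "star (H j - H i) \<noteq> {}"
      using pne[OF ij] by (auto simp: star_Diff starH ij)
    then show "H i - H j \<noteq> {}" "H j - H i \<noteq> {}" by (metis star_empty)+
    show "H i \<union> H j \<noteq> W"
    proof
      \<comment> \<open>Two blobs receive one edge from \<open>s\<close> each, which is too few for
        \<open>deg(s) > 4\<close>.\<close>
      assume "H i \<union> H j = W"
      then have "{p i, p j} = T"
        using star_Un[of "H i" "H j"] star_W starH ij by auto
      then have "card {p i, p j} = degree G s" using card_T by simp
      moreover have "card {p i, p j} \<le> 2" by (simp add: card_insert_if)
      ultimately show False using deg by simp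
    qed
  qed
  have X_eq: "X (nx i) = H i \<union> H (nx i)" if "i < n" for i
  proof -
    let ?j = "nx i"
    have "X ?j = X i \<inter> X ?j \<union> X ?j \<inter> X (nx ?j)"
      using middle_block(2)[of "X i" "X ?j" "X (nx ?j)" "p i" "p ?j"] pairs[OF that] pairs[OF lt(1)[of i]]
        pne[OF that lt(1)] neq(1)[OF that] by (metis Un_commute)
    then show ?thesis by (simp add: H_def)
  qed
  have parts: "X i - X (nx i) = H (pv i)" "X (nx i) - X i = H (nx i)" if "i < n" for i
  proof -
    have "X i = H (pv i) \<union> H i" using X_eq[OF lt(2)[of i]] nxpv[OF that] by simp
    moreover have "H (pv i) \<inter> H i = {}" "H i \<inter> H (nx i) = {}"
      using disj lt that neq by metis+
    moreover have "H i = X i \<inter> X (nx i)" by (simp add: H_def)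
    ultimately show "X i - X (nx i) = H (pv i)" "X (nx i) - X i = H (nx i)"
      using X_eq[OF that] by blast+
  qed
  have cond: "blob_condition G s r (H (pv i)) (H i) (H (nx i))" if "i < n" for i
    using inner_blob(1)[OF pairs[OF that]] parts[OF that] by (simp add: r_def H_def)
  \<comment> \<open>The vertices outside all blobs. Every edge at \<open>s\<close> ends in a blob,
    and a blob has no edges except inside, to its two neighbours and to \<open>s\<close>, so the cut
    of \<open>R\<close> is empty.\<close>
  define R where "R = W - (\<Union>i<n. H i)"
  have "R = {}"
  proof (rule ccontr)
    assume "R \<noteq> {}"
    have RW: "R \<subseteq> W" by (auto simp: R_def)
    have "star R = {}"
    proof -
      have "star R \<subseteq> T - p ` {..<n}"
      proof
        fix e assume e: "e \<in> star R"
        have "e \<notin> star (H i)" if "i < n" for i using e that by (auto simp: star_def R_def)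
        then show "e \<in> T - p ` {..<n}" using e star_subset starH by auto
      qed
      then show ?thesis using T by auto
    qed
    moreover have "m R (W - R) = 0"
    proof -
      have "W - R = (\<Union>i<n. H i)" using HW by (auto simp: R_def)
      moreover have "m R (H i) = 0" if "i < n" for i
      proof -
        have "R \<inter> H j = {}" if "j < n" for j using that by (auto simp: R_def)
        moreover have "X i = H (pv i) \<union> H i" using X_eq[OF lt(2)[of i]] nxpv[OF that] by simp
        ultimately have "R \<inter> (X i \<union> X (nx i)) = {}" using X_eq[OF that] lt that by (simp add: Int_Un_distrib)
        then show ?thesis using inner_blob(2)[OF pairs[OF that] RW] by (simp add: H_def m_commute)
      qed
      ultimately show ?thesis using m_Union_right_eq_0[of "{..<n}" R H] by simp
    qed
    ultimately have "d R = 0" using d_split_s[OF RW] by simp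
    moreover have "R \<noteq> W"
    proof
      assume "R = W"
      moreover have "R \<inter> H 0 = {}" using n unfolding R_def by fastforce
      ultimately have "H 0 = {}" using HW[of 0] n by auto
      then have "star (H 0) = {}" by simp
      then show False using starH[of 0] n by simp
    qed
    ultimately show False using cuts[OF RW \<open>R \<noteq> {}\<close>] k2 by simp
  qed
  then have cov: "(\<Union>i<n. H i) = W" using HW by (auto simp: R_def)
  have "cycle_structure G s r n H"
    unfolding cycle_structure_def blob_cover_def
  proof (intro conjI allI impI)
    show "1 \<le> r" using k2 by (simp add: r_def)
    show "disjoint_family_on H {..<n}" using disj by (auto simp: disjoint_family_on_def)
    show "(\<Union>i<n. H i) = verts G - {s}" using cov by (simp add: W_def)
    fix i assume "i < n"
    then show "blob_condition G s r (H ((i + n - 1) mod n)) (H i) (H ((i + 1) mod n))"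
      using cond[of i] by (simp add: pv_def nx_def)
  qed (rule n)
  moreover have "is_hamilton_cycle C"
    unfolding is_hamilton_cycle_def
  proof (intro exI[of _ "map p [0..<n]"] conjI ballI)
    show "distinct (map p [0..<n])" using injp by (simp add: distinct_map atLeast0LessThan)
    show "set (map p [0..<n]) = verts C" using T by (simp add: atLeast0LessThan)
    fix u v assume uv: "u \<in> verts C" "v \<in> verts C"
    show "adjacent C u v \<longleftrightarrow> (\<exists>i<length (map p [0..<n]). {u, v} =
        {map p [0..<n] ! i, map p [0..<n] ! (Suc i mod length (map p [0..<n]))})"
    proof -
      have "adjacent C u v \<longleftrightarrow> u \<noteq> v \<and> (\<exists>i<n. u \<in> star (X i) \<and> v \<in> star (X i))"
        using uv by (simp add: adjacent_C joint_range[OF XB])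
      also have "\<dots> \<longleftrightarrow> u \<noteq> v \<and> (\<exists>i<n. u \<in> star (X (nx i)) \<and> v \<in> star (X (nx i)))"
        using lt nxpv by metis
      also have "\<dots> \<longleftrightarrow> u \<noteq> v \<and> (\<exists>i<n. u \<in> {p i, p (nx i)} \<and> v \<in> {p i, p (nx i)})"
        using K by (auto simp: nx_def)
      also have "\<dots> \<longleftrightarrow> (\<exists>i<n. {u, v} = {p i, p (nx i)})"
      proof
        assume "\<exists>i<n. {u, v} = {p i, p (nx i)}"
        then obtain i where i: "i < n" "{u, v} = {p i, p (nx i)}" by blast
        then have "p i \<noteq> p (nx i)" using pne[OF i(1) lt(1)] neq(1)[OF i(1)] by simp
        then show "u \<noteq> v \<and> (\<exists>i<n. u \<in> {p i, p (nx i)} \<and> v \<in> {p i, p (nx i)})"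
          using i by (auto simp: doubleton_eq_iff)
      qed blast
      also have "\<dots> \<longleftrightarrow> (\<exists>i<n. {u, v} = {map p [0..<n] ! i, map p [0..<n] ! nx i})"
        using lt(1) by (intro ex_cong conj_cong) auto
      finally show ?thesis by (simp add: nx_def)
    qed
  qed (use n in auto)
  moreover have "edge_connected (nat \<lceil>real k / 2\<rceil>) (induced_subgraph G (H i))" if "i < n" for i
    using edge_connected_tight[OF HW HneW dH] that by blast
  ultimately show structured unfolding structured_def r_def by blast
qed

text \<open>Inner blobs arise as in the cycle. The two end blobs satisfy no blob condition, but
  their cuts have size \<open>k\<close> by \<open>share\<close>; this suffices both for disjointness
  and for the edge counts that give covering and equal clique sizes.\<close>

lemma path_case:
  assumes nosp: "\<And>X Y. \<not> special_pair X Y"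
    and n2: "n \<ge> 2" and XB: "X ` {..<n} = {X. block X}" and injX: "inj_on X {..<n}"
    and injp: "inj_on p {..<n - 1}"
    and p: "\<And>i. Suc i < n \<Longrightarrow> p i \<in> star (X i) \<inter> star (X (Suc i))"
    and K: "\<And>i. Suc (Suc i) < n \<Longrightarrow> star (X (Suc i)) = {p i, p (Suc i)}"
    and far: "n \<ge> 3 \<Longrightarrow> star (X 0) \<inter> star (X (n - 1)) = {}"
    and T: "T = (\<Union>i<n. star (X i))"
  shows structured "odd k"
proof -
  define r where "r = k div 2"
  have blk: "block (X i)" if "i < n" for i using XB that by blast
  have Xne: "X i \<noteq> X j" if "i < n" "j < n" "i \<noteq> j" for i j using injX that by (auto dest: inj_onD)
  have pX: "p i \<in> star (X i)" "p i \<in> star (X (Suc i))" if "Suc i < n" for i using p[OF that] by auto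
  have pne: "p i \<noteq> p j" if "Suc i < n" "Suc j < n" "i \<noteq> j" for i j
  proof -
    have "i \<in> {..<n - 1}" "j \<in> {..<n - 1}" using that by auto
    then show ?thesis using injp that(3) by (auto dest: inj_onD)
  qed
  have pairs: "block (X i)" "block (X (Suc i))" "X i \<noteq> X (Suc i)" "p i \<in> star (X i)"
      "p i \<in> star (X (Suc i))" "X i \<union> X (Suc i) \<noteq> W" if "Suc i < n" for i
  proof -
    show b: "block (X i)" "block (X (Suc i))" "X i \<noteq> X (Suc i)" "p i \<in> star (X i)"
      "p i \<in> star (X (Suc i))" using that blk pX Xne[of i "Suc i"] by auto
    then show "X i \<union> X (Suc i) \<noteq> W"
      using nosp[of "X i" "X (Suc i)"] unfolding special_pair_def by blast
  qed
  have odd: "odd k" using share_proper(1)[OF pairs[of 0]] n2 by simp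
  then show "odd k" .
  have k: "k = 2 * r + 1" using odd by (simp add: r_def)
  \<comment> \<open>Two overlapping blocks hold at most \<open>(deg(s) + 2) / 2\<close> edges at
    \<open>s\<close> together, so two blocks cannot cover \<open>T\<close>.\<close>
  have n: "n \<ge> 3"
  proof (rule ccontr)
    assume "\<not> n \<ge> 3"
    then have "n = 2" using n2 by simp
    then have "T = star (X 0) \<union> star (X (Suc 0))" using T by (auto simp: less_2_cases_iff)
    then have "2 * degree G s \<le> degree G s + 2"
      using share_star_bound[OF pairs[of 0]] n2 card_T by simp
    then show False using deg by simp
  qed
  have p_in: "i = j \<or> i = Suc j" if "Suc j < n" "i < n" "p j \<in> star (X i)" for i j
  proof (rule ccontr)
    assume "\<not> ?thesis"
    then have "X i \<noteq> X j" "X i \<noteq> X (Suc j)" using Xne that by auto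
    then show False using no_triple[OF blk[OF that(2)] pairs(1,2)[OF that(1)] that(3) pairs(4,5)[OF that(1)]]
        pairs(3)[OF that(1)] by blast
  qed
  \<comment> \<open>The \<open>n\<close> blocks give \<open>n + 1\<close> blobs: the
    \<open>n - 1\<close> consecutive intersections and, at each end, the part of the end block
    outside its neighbour.\<close>
  define H where "H = (\<lambda>j. if j = 0 then X 0 - X 1 else if j < n then X (j - 1) \<inter> X j
    else X (n - 1) - X (n - 2))"
  have H0: "H 0 = X 0 - X 1" and Hn: "H n = X (n - 1) - X (n - 2)"
    and Hi: "\<And>i. Suc i < n \<Longrightarrow> H (Suc i) = X i \<inter> X (Suc i)"
    using n by (auto simp: H_def)
  have sn: "Suc (n - 2) = n - 1" "n - 1 < n" "Suc (n - 2) < n" "Suc (n - 1) = n" using n by auto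
  have first: "Suc 0 < n" using n by simp
  note pF = pairs[OF first] and pL = pairs[OF sn(3), unfolded sn(1)]
  note shF = share[OF pF(1-5)] and shL = share[OF pL(1-5)]
  have starH0: "star (H 0) = star (X 0) - {p 0}"
    using shF(5) by (auto simp: H0 star_Diff)
  have starHn: "star (H n) = star (X (n - 1)) - {p (n - 2)}"
    using shL(5) by (auto simp: Hn star_Diff)
  have starHi: "star (H (Suc i)) = {p i}" if "Suc i < n" for i
    using share(5)[OF pairs(1-5)[OF that]] by (simp add: Hi[OF that] star_Int)
  have idx: "j = 0 \<or> j = n \<or> (\<exists>i. j = Suc i \<and> Suc i < n)" if "j \<le> n" for j
    using that by (cases j) auto
  have dH: "d (H j) = k" if j: "j \<le> n" for j
  proof -
    consider "j = 0" | "j = n" | i where "j = Suc i" "Suc i < n" using idx[OF j] by blast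
    then show ?thesis
    proof cases
      case 1
      then show ?thesis using shF(3) by (simp add: H0)
    next
      case 2
      then show ?thesis using shL(4) by (simp add: Hn)
    next
      case 3
      then show ?thesis using share_proper(2)[OF pairs[OF 3(2)]] by (simp add: Hi)
    qed
  qed
  have HW: "H j \<subseteq> W" "H j \<noteq> W" if "j \<le> n" for j
  proof -
    have "H j \<subseteq> X (if j < n then j else n - 1)" by (auto simp: H_def)
    moreover have b: "block (X (if j < n then j else n - 1))" using blk n by simp
    ultimately show "H j \<subseteq> W" "H j \<noteq> W" using blockD(1,3)[OF b] by blast+
  qed
  have ne: "star (H j) \<noteq> {}" if "j \<le> n" for j
  proof -
    have "star (X i) - {q} \<noteq> {}" if "i < n" for i q
    proof
      assume "star (X i) - {q} = {}"
      then have "card (star (X i)) \<le> card {q}" by (intro card_mono) auto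
      then show False using blockD(5)[OF blk[OF that]] by simp
    qed
    then show ?thesis using idx[OF that] starH0 starHn starHi n by auto
  qed
  have sdisj': "star (H i) \<inter> star (H j) = {}" if "i < j" "j \<le> n" for i j
  proof -
    have "p l \<notin> star (H 0)" if "Suc l < n" for l
      using p_in[OF that, of 0] n by (auto simp: starH0)
    moreover have "p l \<notin> star (H n)" if "Suc l < n" for l
      using p_in[OF that, of "n - 1"] sn that by (auto simp: starHn)
    moreover have "star (H 0) \<inter> star (H n) = {}" using far[OF n] by (auto simp: starH0 starHn)
    moreover have "i = 0 \<or> (\<exists>l. i = Suc l \<and> Suc l < n)" "j = n \<or> (\<exists>l. j = Suc l \<and> Suc l < n)"
      using idx[of i] idx[of j] that by auto
    ultimately show ?thesis using starHi pne that by auto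
  qed
  have sdisj: "star (H i) \<inter> star (H j) = {}" if "i \<le> n" "j \<le> n" "i \<noteq> j" for i j
    using sdisj'[of i j] sdisj'[of j i] that by (cases i j rule: linorder_cases) auto
  have disj: "H i \<inter> H j = {}" if ij: "i \<le> n" "j \<le> n" "i \<noteq> j" for i j
  proof (rule tight_disjoint)
    show "H i \<subseteq> W" "H j \<subseteq> W" "d (H i) = k" "d (H j) = k" "odd k"
      using HW dH ij odd by auto
    have "star (H i - H j) \<noteq> {}" "star (H j - H i) \<noteq> {}"
      using sdisj[OF ij] ne ij unfolding star_Diff by blast+
    then show "H i - H j \<noteq> {}" "H j - H i \<noteq> {}" by (metis star_empty)+
    show "H i \<union> H j \<noteq> W"
    proof
      assume eq: "H i \<union> H j = W"
      \<comment> \<open>There are at least four blobs, so a third one exists; it has an edge to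
        \<open>s\<close> that the other two would have to contain.\<close>
      have "0 \<notin> {i, j} \<or> 1 \<notin> {i, j} \<or> 2 \<notin> {i, j}" by auto
      then obtain l where l: "l \<le> n" "l \<noteq> i" "l \<noteq> j" using n by fastforce
      have "star (H l) \<subseteq> star (H i) \<union> star (H j)"
        using star_mono[OF HW(1)[OF l(1)]] unfolding star_Un[symmetric] eq .
      then show False using sdisj[OF l(1) ij(1) l(2)] sdisj[OF l(1) ij(2) l(3)] ne[OF l(1)] by blast
    qed
  qed
  have X_eq: "X i = H i \<union> H (Suc i)" if "i < n" for i
  proof -
    have "i = 0 \<or> i = n - 1 \<and> i \<noteq> 0 \<or> (\<exists>l. i = Suc l \<and> Suc (Suc l) < n)"
      using that by (cases i) auto
    then consider "i = 0" | "i = n - 1" "i \<noteq> 0" | l where "i = Suc l" "Suc (Suc l) < n" by blast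
    then show ?thesis
    proof cases
      case 1
      then show ?thesis using Hi[OF first] by (auto simp: H0)
    next
      case 2
      then have "i = Suc (n - 2)" using sn by simp
      then show ?thesis using Hi[OF sn(3)] Hn 2 sn by auto
    next
      case (3 l)
      have lt: "Suc l < n" using 3 by simp
      have "X i = X l \<inter> X i \<union> X i \<inter> X (Suc i)"
        unfolding 3(1)
        by (rule middle_block(2)[OF pairs(1,2)[OF lt] pairs(2)[OF 3(2)] pairs(3)[OF lt]
            pairs(3)[OF 3(2), symmetric] pairs(4,5)[OF lt] pairs(4,5)[OF 3(2)] pne[OF lt 3(2)]
            pairs(6)[OF lt]])
          (use pairs(6)[OF 3(2)] in \<open>auto simp: Un_commute\<close>)
      then show ?thesis using Hi[OF lt] Hi[OF 3(2)] 3(1) by simp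
    qed
  qed
  have parts: "X i - X (Suc i) = H i" "X (Suc i) - X i = H (Suc (Suc i))" if "Suc i < n" for i
  proof -
    have "X i = H i \<union> H (Suc i)" "X (Suc i) = H (Suc i) \<union> H (Suc (Suc i))"
      using X_eq that by simp_all
    moreover have "H i \<inter> H (Suc i) = {}" "H (Suc i) \<inter> H (Suc (Suc i)) = {}" "H i \<inter> H (Suc (Suc i)) = {}"
      using disj that by simp_all
    ultimately show "X i - X (Suc i) = H i" "X (Suc i) - X i = H (Suc (Suc i))" by blast+
  qed
  have cond: "blob_condition G s r (H i) (H (Suc i)) (H (Suc (Suc i)))" if "Suc i < n" for i
    using inner_blob(1)[OF pairs[OF that]] parts[OF that] by (simp add: r_def Hi[OF that])
  have m_near: "m (H (Suc i)) (H i) = r" "m (H (Suc i)) (H (Suc (Suc i))) = r" if "Suc i < n" for i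
    using share_proper(4,5)[OF pairs[OF that]] parts[OF that] by (simp_all add: r_def Hi[OF that])
  have m_far: "m S (H (Suc i)) = 0"
    if "Suc i < n" "S \<subseteq> W" "S \<inter> H i = {}" "S \<inter> H (Suc i) = {}" "S \<inter> H (Suc (Suc i)) = {}" for i S
  proof -
    have "S \<inter> (X i \<union> X (Suc i)) = {}" using that X_eq[of i] X_eq[of "Suc i"] by auto
    then show ?thesis using inner_blob(2)[OF pairs[OF that(1)] that(2)] Hi[OF that(1)]
      by (simp add: m_commute)
  qed
  define M where "M = (\<Union>j\<in>{1..<n}. H j)"
  define R where "R = W - (\<Union>j\<in>{..n}. H j)"
  have split: "{..n} = insert 0 (insert n {1..<n})" using n by auto
  then have allH: "(\<Union>j\<in>{..n}. H j) = H 0 \<union> M \<union> H n" by (auto simp: M_def)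
  have allW: "H 0 \<union> M \<union> H n \<subseteq> W" unfolding allH[symmetric] using HW(1) by auto
  have R_H: "R \<inter> H j = {}" if "j \<le> n" for j using that by (auto simp: R_def)
  have RW: "R \<subseteq> W" by (auto simp: R_def)
  \<comment> \<open>Of the \<open>k\<close> edges leaving \<open>H j\<close>, \<open>r\<close> go to
    the neighbour \<open>H l\<close> and at least one goes to \<open>s\<close>.\<close>
  have R_end: "m R (H j) + r + 1 \<le> k" if j: "j \<le> n" and l: "l \<le> n" "l \<noteq> j" "m (H j) (H l) = r" for j l
  proof -
    have "m (H j) (R \<union> H l) = m (H j) R + m (H j) (H l)"
      using R_H j l by (intro m_Un_right) (auto simp: Int_commute)
    moreover have "m (H j) (R \<union> H l) \<le> m (H j) (W - H j)"
      using RW HW(1)[OF l(1)] R_H[OF j] disj[OF j l(1)] l(2) by (intro m_mono) auto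
    moreover have "card (star (H j)) \<ge> 1" using ne[OF j] by (simp add: Suc_le_eq card_gt_0_iff)
    ultimately show ?thesis
      using d_split_s[OF HW(1)[OF j]] dH[OF j] l(3) m_commute[of R "H j"] by linarith
  qed
  have near0: "m (H 0) (H (Suc 0)) = r" using m_near(1)[OF first] by (simp add: m_commute)
  have nearn: "m (H n) (H (n - 1)) = r" using m_near(2)[OF sn(3)] sn by (simp add: m_commute)
  \<comment> \<open>Only the two end blobs can have edges to \<open>R\<close>, each at most
    \<open>k - r - 1 = r\<close>, so the cut of \<open>R\<close> has at most
    \<open>2 * r < k\<close> edges.\<close>
  have "R = {}"
  proof (rule ccontr)
    assume "R \<noteq> {}"
    have "R \<noteq> W"
    proof
      assume "R = W"
      then have "H 0 = {}" using R_H[of 0] HW(1)[of 0] by auto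
      then show False using ne[of 0] by simp
    qed
    then have "k \<le> d R" using cuts[OF RW \<open>R \<noteq> {}\<close>] by simp
    moreover have "star R = {}"
    proof -
      have "star R \<inter> star (X i) = {}" if "i < n" for i
      proof -
        have "R \<inter> X i = {}" using X_eq[OF that] R_H[of i] R_H[of "Suc i"] that by auto
        then show ?thesis using star_Int[of R "X i"] by simp
      qed
      then show ?thesis using T star_subset[of R] by blast
    qed
    moreover have "m R (W - R) \<le> m R (H 0) + m R M + m R (H n)"
    proof -
      have "W - R = H 0 \<union> M \<union> H n" using allW unfolding R_def allH by blast
      then have "m R (W - R) = m (H 0 \<union> M \<union> H n) R" by (simp add: m_commute)
      then show ?thesis using m_Un_left_le[of "H 0 \<union> M" "H n" R] m_Un_left_le[of "H 0" M R]
        by (simp add: m_commute)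
    qed
    moreover have "m R M = 0"
      unfolding M_def
    proof (rule m_Union_right_eq_0)
      fix j assume "j \<in> {1..<n}"
      then obtain i where "j = Suc i" "Suc i < n" by (cases j) auto
      then show "m R (H j) = 0" using m_far[OF _ RW] R_H by simp
    qed
    moreover have "m R (H 0) + r + 1 \<le> k" using R_end[of 0 "Suc 0"] near0 n by simp
    moreover have "m R (H n) + r + 1 \<le> k" using R_end[of n "n - 1"] nearn n by simp
    ultimately show False using d_split_s[OF RW] k by simp
  qed
  then have cov: "H 0 \<union> M \<union> H n = W" using allW unfolding R_def allH by blast
  have Un_disj: "(\<Union>i\<in>I. H i) \<inter> H j = {}" if I: "I \<subseteq> {..n}" "j \<le> n" "j \<notin> I" for I j
  proof -
    have "H i \<inter> H j = {}" if "i \<in> I" for i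
    proof (rule disj)
      show "i \<le> n" "i \<noteq> j" using that I by auto
    qed (rule I(2))
    then show ?thesis by blast
  qed
  \<comment> \<open>Both ends are treated at once: \<open>a\<close> is the neighbour of the end blob
    \<open>j\<close>, and \<open>l\<close> is the opposite end. All other blobs have no edges to
    \<open>H j\<close>.\<close>
  have side: "m (H j) (W - H j) = r + m (H j) (H l)"
    if jl: "j = 0 \<and> l = n \<and> a = Suc 0 \<or> j = n \<and> l = 0 \<and> a = n - 1" for j l a
  proof -
    have le: "j \<le> n" "l \<le> n" "a \<le> n" "j \<noteq> l" "a \<noteq> j" "a \<noteq> l" "a \<in> {1..<n}" using jl n by auto
    define N where "N = (\<Union>i\<in>{1..<n} - {a}. H i)"
    have "M = H a \<union> N" using le(7) by (auto simp: M_def N_def)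
    moreover have "M \<inter> H j = {}"
      unfolding M_def by (rule Un_disj) (use jl in auto)
    moreover have "H l \<inter> H j = {}" by (rule disj) (use le in auto)
    moreover have "H j \<union> M \<union> H l = W" using cov jl by blast
    ultimately have "W - H j = H a \<union> (N \<union> H l)" by blast
    moreover have "m (H j) (H a \<union> (N \<union> H l)) = m (H j) (H a) + (m (H j) N + m (H j) (H l))"
    proof -
      have "N \<inter> H a = {}" unfolding N_def by (rule Un_disj) (use le in auto)
      moreover have "H l \<inter> H a = {}" "H a \<inter> H j = {}" using disj le by auto
      moreover have "N \<inter> H l = {}" "N \<inter> H j = {}"
        unfolding N_def by (rule Un_disj; use jl in auto)+
      ultimately have "H a \<inter> (N \<union> H l) = {}" "N \<inter> H l = {}" "H a \<inter> H j = {}" "N \<inter> H j = {}"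
        by blast+
      then show ?thesis by (simp add: m_Un_right)
    qed
    moreover have "m (H j) N = 0"
      unfolding N_def
    proof (rule m_Union_right_eq_0)
      fix i assume i: "i \<in> {1..<n} - {a}"
      then obtain b where b: "i = Suc b" "Suc b < n" by (cases i) auto
      have "j \<noteq> b" "j \<noteq> Suc b" "j \<noteq> Suc (Suc b)" using jl b i by auto
      then show "m (H j) (H i) = 0"
        using m_far[OF b(2) HW(1)[OF le(1)]] disj[OF le(1), of b] disj[OF le(1), of "Suc b"]
          disj[OF le(1), of "Suc (Suc b)"] b by simp
    qed
    moreover have "m (H j) (H a) = r" using jl near0 nearn by auto
    ultimately show ?thesis by simp
  qed
  \<comment> \<open>Each end blob has cut \<open>k\<close>, made up of \<open>r\<close> edges to its
    neighbour, the common number of edges joining the two ends, and its edges to \<open>s\<close>.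
    This is why the cliques have the same size.\<close>
  have "card (star (H 0)) = card (star (H n))"
    using side[of 0 n "Suc 0"] side[of n 0 "n - 1"] d_split_s[OF HW(1), of 0] d_split_s[OF HW(1), of n]
      dH[of 0] dH[of n] m_commute[of "H 0" "H n"] by simp
  moreover have "card (star (X 0)) = Suc (card (star (H 0)))"
    unfolding starH0 using pF(4) by (intro card_Suc_Diff1[symmetric]) auto
  moreover have "card (star (X (n - 1))) = Suc (card (star (H n)))"
    unfolding starHn using pL(5) by (intro card_Suc_Diff1[symmetric]) auto
  ultimately have size: "card (star (X 0)) = card (star (X (n - 1)))" by simp
  have "path_structure G s r (n + 1) H"
    unfolding path_structure_def blob_cover_def
  proof (intro conjI allI impI)
    show "1 \<le> r" using k2 by (simp add: r_def)
    show "disjoint_family_on H {..<n + 1}" using disj by (auto simp: disjoint_family_on_def)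
    show "(\<Union>i<n + 1. H i) = verts G - {s}"
      using cov allH by (simp add: W_def lessThan_Suc_atMost)
    fix i assume "1 \<le> i \<and> i \<le> n + 1 - 2"
    then obtain j where "i = Suc j" "Suc j < n" using n by (cases i) auto
    then show "blob_condition G s r (H (i - 1)) (H i) (H (i + 1))" using cond[of j] by simp
  qed (use n in simp)
  moreover have "two_equal_cliques_joined_by_path C"
  proof -
    define q where "q = map p [0..<n - 1]"
    have q: "length q = n - 1" "q \<noteq> []" "distinct q" "hd q = p 0" "last q = p (n - 2)"
      "\<And>i. Suc i < n \<Longrightarrow> q ! i = p i" "set q = p ` {..<n - 1}"
      using n injp by (auto simp: q_def distinct_map atLeast0LessThan hd_map last_map hd_conv_nth
          last_conv_nth numeral_2_eq_2)
    have p_ends: "p j \<in> star (X 0) \<Longrightarrow> j = 0" "p j \<in> star (X (n - 1)) \<Longrightarrow> j = n - 2"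
      if "j < n - 1" for j
      using p_in[of j 0] p_in[of j "n - 1"] that n by auto
    have inner: "star (X i) \<subseteq> set q" if i: "i < n" "i \<noteq> 0" "i \<noteq> n - 1" for i
    proof -
      obtain l where l: "i = Suc l" "Suc (Suc l) < n" using i by (cases i) auto
      then show ?thesis using K[OF l(2)] unfolding q(7) by auto
    qed
    have verts: "T = star (X 0) \<union> star (X (n - 1)) \<union> set q"
    proof
      show "T \<subseteq> star (X 0) \<union> star (X (n - 1)) \<union> set q"
      proof
        fix e assume "e \<in> T"
        then have "e \<in> (\<Union>i<n. star (X i))" using T by (rule subst[rotated])
        then obtain i where i: "i < n" "e \<in> star (X i)" by blast
        show "e \<in> star (X 0) \<union> star (X (n - 1)) \<union> set q"
        proof (cases "i = 0 \<or> i = n - 1")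
          case True
          then show ?thesis using i(2) by blast
        next
          case False
          then show ?thesis using inner[OF i(1)] i(2) by blast
        qed
      qed
      have "p j \<in> T" if "j < n - 1" for j
      proof -
        have "Suc j < n" using that by simp
        then show ?thesis using pX(1) star_subset by blast
      qed
      then show "star (X 0) \<union> star (X (n - 1)) \<union> set q \<subseteq> T" using star_subset q(7) by auto
    qed
    have adj: "adjacent C u v \<longleftrightarrow> u \<noteq> v \<and> (u \<in> star (X 0) \<and> v \<in> star (X 0) \<or>
        u \<in> star (X (n - 1)) \<and> v \<in> star (X (n - 1)) \<or>
        (\<exists>i. Suc i < length q \<and> {u, v} = {q ! i, q ! Suc i}))" if uv: "u \<in> T" "v \<in> T" for u v
    proof -
      have step: "{q ! i, q ! Suc i} = star (X (Suc i))" if "Suc i < length q" for i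
        using that q(1,6) K[of i] by simp
      have "adjacent C u v \<longleftrightarrow> u \<noteq> v \<and> (\<exists>i<n. u \<in> star (X i) \<and> v \<in> star (X i))"
        using uv by (simp add: adjacent_C joint_range[OF XB])
      also have "\<dots> \<longleftrightarrow> u \<noteq> v \<and> (u \<in> star (X 0) \<and> v \<in> star (X 0) \<or>
        u \<in> star (X (n - 1)) \<and> v \<in> star (X (n - 1)) \<or>
        (\<exists>i. Suc i < length q \<and> u \<in> star (X (Suc i)) \<and> v \<in> star (X (Suc i))))"
      proof -
        have "(\<exists>i<n. P i) \<longleftrightarrow> P 0 \<or> P (n - 1) \<or> (\<exists>i. Suc i < length q \<and> P (Suc i))" for P
        proof
          assume "\<exists>i<n. P i"
          then obtain i where i: "i < n" "P i" by blast
          then show "P 0 \<or> P (n - 1) \<or> (\<exists>i. Suc i < length q \<and> P (Suc i))"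
            unfolding q(1) by (cases i; cases "i = n - 1") auto
        next
          assume "P 0 \<or> P (n - 1) \<or> (\<exists>i. Suc i < length q \<and> P (Suc i))"
          moreover have "Suc i < n" if "Suc i < length q" for i using that unfolding q(1) by simp
          moreover have "0 < n" using n by simp
          ultimately show "\<exists>i<n. P i" using sn(2) by blast
        qed
        from this[of "\<lambda>i. u \<in> star (X i) \<and> v \<in> star (X i)"] show ?thesis by simp
      qed
      also have "\<dots> \<longleftrightarrow> u \<noteq> v \<and> (u \<in> star (X 0) \<and> v \<in> star (X 0) \<or>
        u \<in> star (X (n - 1)) \<and> v \<in> star (X (n - 1)) \<or>
        (\<exists>i. Suc i < length q \<and> {u, v} = {q ! i, q ! Suc i}))"
      proof -
        have "u \<in> star (X (Suc i)) \<and> v \<in> star (X (Suc i)) \<longleftrightarrow> {u, v} = {q ! i, q ! Suc i}"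
          if "Suc i < length q" "u \<noteq> v" for i
          unfolding step[OF that(1), symmetric] using that(2) by auto
        then show ?thesis by blast
      qed
      finally show ?thesis .
    qed
    show ?thesis
      unfolding two_equal_cliques_joined_by_path_def verts_C
    proof (rule exI[of _ "star (X 0)"], rule exI[of _ "star (X (n - 1))"], rule exI[of _ q],
        intro conjI ballI)
      show "star (X 0) \<inter> set q = {hd q}"
        using pF(4) p_ends(1) n unfolding q(4,7) by auto
      have "p (n - 2) \<in> p ` {..<n - 1}" using n by (intro imageI) auto
      then show "star (X (n - 1)) \<inter> set q = {last q}"
        using pL(5) p_ends(2) unfolding q(5,7) by auto
      show "star (X 0) \<inter> star (X (n - 1)) \<subseteq> set q" using far[OF n] by simp
    qed (use verts size q(2,3) adj in auto)
  qed
  moreover have "edge_connected (nat \<lceil>real k / 2\<rceil>) (induced_subgraph G (H i))" if "i < n + 1" for i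
    using edge_connected_tight[OF HW dH] that by auto
  ultimately show structured unfolding structured_def r_def by blast
qed

section \<open>Combination of the cases\<close>

lemma structured_if_connected:
  assumes conn: "connected_graph C" and nosp: "\<And>X Y. \<not> special_pair X Y"
  shows "structured \<and> odd k"
proof (rule chain_structure[of "{X. block X}" star T])
  have "{X. block X} \<subseteq> Pow W" using blockD(1) by blast
  then show "finite {X. block X}" using finite_W by (meson finite_Pow_iff finite_subset)
  have cross: "\<exists>X. block X \<and> star X \<inter> U \<noteq> {} \<and> \<not> star X \<subseteq> U"
    if U: "U \<subseteq> T" "U \<noteq> {}" "U \<noteq> T" for U
  proof -
    obtain u v where "u \<in> U" "v \<in> T - U" "adjacent C u v"
      using conn U unfolding connected_C_iff by blast
    then show ?thesis unfolding adjacent_C joint_def by blast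
  qed
  then show "\<exists>X\<in>{X. block X}. star X \<inter> U \<noteq> {} \<and> \<not> star X \<subseteq> U"
    if "U \<subseteq> T" "U \<noteq> {}" "U \<noteq> T" for U
    using that by blast
  have "T \<noteq> {}" using card_T deg by auto
  then obtain e where "e \<in> T" by blast
  then show "{X. block X} \<noteq> {}" using cross[of "{e}"] T_not_singleton by blast
  show "star X \<subseteq> T" for X by (rule star_subset)
  show "star X \<noteq> T" if "X \<in> {X. block X}" for X
  proof
    assume "star X = T"
    then show False using block_star_bound[of X] that deg card_T by simp
  qed
  show "star X \<noteq> {}" if "X \<in> {X. block X}" for X using blockD(5)[of X] that by auto
  show "a = b" if "X \<in> {X. block X}" "Y \<in> {X. block X}" "a \<in> star X" "a \<in> star Y" "b \<in> star X"
    "b \<in> star Y" "X \<noteq> Y" for X Y a b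
    using block_eqI[of X Y a b] that by blast
  show "X = Y \<or> Y = Z \<or> X = Z" if "X \<in> {X. block X}" "Y \<in> {X. block X}" "Z \<in> {X. block X}"
    "p \<in> star X" "p \<in> star Y" "p \<in> star Z" for X Y Z p
    using no_triple[of X Y Z p] that by blast
  show "star Y = {p, q}" if "X \<in> {X. block X}" "Y \<in> {X. block X}" "Z \<in> {X. block X}" "X \<noteq> Y" "Z \<noteq> Y"
    "p \<in> star X" "p \<in> star Y" "q \<in> star Y" "q \<in> star Z" "p \<noteq> q" for X Y Z p q
  proof (rule middle_block(1))
    show "X \<union> Y \<noteq> W" using nosp[of X Y] that unfolding special_pair_def by blast
    show "Z \<union> Y \<noteq> W" using nosp[of Z Y] that unfolding special_pair_def by blast
  qed (use that in simp_all)
next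
  fix n and X :: "nat \<Rightarrow> 'v set" and p :: "nat \<Rightarrow> 'e"
  assume a: "n \<ge> 2" "X ` {..<n} = {X. block X}" "inj_on X {..<n}" "inj_on p {..<n - 1}"
    "\<And>i. Suc i < n \<Longrightarrow> p i \<in> star (X i) \<inter> star (X (Suc i))"
    "\<And>i. Suc (Suc i) < n \<Longrightarrow> star (X (Suc i)) = {p i, p (Suc i)}"
    "n \<ge> 3 \<Longrightarrow> star (X 0) \<inter> star (X (n - 1)) = {}"
    "T = (\<Union>i<n. star (X i))"
  show "structured \<and> odd k" using path_case[OF nosp a] by (rule conjI)
next
  fix n and X :: "nat \<Rightarrow> 'v set" and p :: "nat \<Rightarrow> 'e"
  assume a: "n \<ge> 3" "X ` {..<n} = {X. block X}" "inj_on X {..<n}" "inj_on p {..<n}"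
    "\<And>i. i < n \<Longrightarrow> p i \<in> star (X i) \<inter> star (X (Suc i mod n))"
    "\<And>i. i < n \<Longrightarrow> star (X (Suc i mod n)) = {p i, p (Suc i mod n)}"
    "T = p ` {..<n}"
  show "structured \<and> odd k" using cycle_case[OF nosp a] by (rule conjI)
qed

end

theorem theorem1p5:
  fixes G :: "('v, 'e) mgraph" and s :: 'v and k :: nat
  assumes "finite_loopless_multigraph G"
    and "sk_edge_connected G s k"
    and "k \<ge> 2"
    and "degree G s > 4"
  shows
    "(\<not> connected_graph (lifting_graph G s k) \<longrightarrow>
        odd (degree G s) \<and> isolated_plus_balanced_complete_bipartite (lifting_graph G s k)) \<and>
     (even k \<longrightarrow>
        complete_multipartite (lifting_graph G s k) \<or>
        isolated_plus_balanced_complete_bipartite (lifting_graph G s k)) \<and>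
     (connected_graph (complement_graph (lifting_graph G s k)) \<longrightarrow>
        (is_hamilton_cycle (complement_graph (lifting_graph G s k)) \<or>
         two_equal_cliques_joined_by_path (complement_graph (lifting_graph G s k))) \<and>
        (\<not> isolated_plus_balanced_complete_bipartite (lifting_graph G s k) \<longrightarrow> odd k) \<and>
        (\<exists>r n H.
           ((is_hamilton_cycle (complement_graph (lifting_graph G s k)) \<and>
               cycle_structure G s r n H) \<or>
            (two_equal_cliques_joined_by_path (complement_graph (lifting_graph G s k)) \<and>
               path_structure G s r n H)) \<and>
           (if isolated_plus_balanced_complete_bipartite (lifting_graph G s k)
            then n = 3 \<and> real r \<ge> (real k - 1) / 2
            else real r = (real k - 1) / 2) \<and>
           (\<forall>i<n. \<not> (isolated_plus_balanced_complete_bipartite (lifting_graph G s k) \<and> i = 1) \<longrightarrow>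
              edge_connected (nat \<lceil>real k / 2\<rceil>) (induced_subgraph G (H i)))))"
proof -
  interpret lifting G s k using assms by unfold_locales
  show ?thesis
  proof (cases "\<exists>X Y. special_pair X Y")
    case True
    then obtain X Y where sp: "special_pair X Y" by blast
    note iso = special_isolated[OF sp] and cliques = special_structure(1)[OF sp]
    obtain r H where "path_structure G s r 3 H" "(real k - 1) / 2 \<le> real r"
      "\<forall>i<3. i \<noteq> 1 \<longrightarrow> edge_connected (nat \<lceil>real k / 2\<rceil>) (induced_subgraph G (H i))"
      using special_structure(2)[OF sp] by blast
    then have "\<exists>r n H. (is_hamilton_cycle C \<and> cycle_structure G s r n H \<or>
        two_equal_cliques_joined_by_path C \<and> path_structure G s r n H) \<and>
      (if isolated_plus_balanced_complete_bipartite L then n = 3 \<and> (real k - 1) / 2 \<le> real r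
        else real r = (real k - 1) / 2) \<and>
      (\<forall>i<n. \<not> (isolated_plus_balanced_complete_bipartite L \<and> i = 1) \<longrightarrow>
        edge_connected (nat \<lceil>real k / 2\<rceil>) (induced_subgraph G (H i)))"
      using iso(1) cliques by (intro exI[of _ r] exI[of _ "3::nat"] exI[of _ H]) simp
    then show ?thesis using iso cliques by blast
  next
    case False
    then have nosp: "\<And>X Y. \<not> special_pair X Y" by blast
    have iso: "\<not> isolated_plus_balanced_complete_bipartite L" using isolated_imp_special False by blast
    have conn: "connected_graph L" using disconnected_special False by blast
    have "(is_hamilton_cycle C \<or> two_equal_cliques_joined_by_path C) \<and> odd k \<and>
      (\<exists>r n H. (is_hamilton_cycle C \<and> cycle_structure G s r n H \<or>
        two_equal_cliques_joined_by_path C \<and> path_structure G s r n H) \<and> real r = (real k - 1) / 2 \<and>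
        (\<forall>i<n. edge_connected (nat \<lceil>real k / 2\<rceil>) (induced_subgraph G (H i))))"
      if "connected_graph C"
    proof -
      have str: structured and odd: "odd k" using structured_if_connected[OF that nosp] by blast+
      obtain n H where nH: "is_hamilton_cycle C \<and> cycle_structure G s (k div 2) n H \<or>
          two_equal_cliques_joined_by_path C \<and> path_structure G s (k div 2) n H"
        "\<forall>i<n. edge_connected (nat \<lceil>real k / 2\<rceil>) (induced_subgraph G (H i))"
        using str unfolding structured_def by blast
      \<comment> \<open>The quotient \<open>k div 2\<close> is the required \<open>r\<close> only
        because \<open>k\<close> is odd here.\<close>
      have "real (k div 2) = (real k - 1) / 2" using odd by (auto elim!: oddE)
      then show ?thesis using nH odd by blast
    qed
    then show ?thesis using iso conn even_multipartite[OF _ nosp] by simp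
  qed
qed

end
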